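(* Let $G$ be a compact Hausdorff abelian torsion-free topological group. If $G$ is dense-subgroup-separable, then $G$ is metrizable; thus $G$ is dense-separable.
   Context: A group is torsion-free if it has no elements of finite order except for the neutral element. A topological group is dense-subgroup-separable if each of its dense subgroups is separable. A space is dense-separable if each of its dense subspaces is separable. *)

theory Defs
  imports "HOL-Analysis.Analysis"
begin

text \<open>
  Groups are written additively, so that the class \<^class>\<open>topological_ab_group_add\<close> applies.
  The group-theoretic predicates below take a group as a subset of a type;
  the group consisting of the whole type is \<^term>\<open>UNIV\<close>.
\<close>

definition add_subgroup :: "'a::group_add set \<Rightarrow> bool"
  where "add_subgroup H \<longleftrightarrow>
    0 \<in> H \<and> (\<forall>x\<in>H. \<forall>y\<in>H. x + y \<in> H) \<and> (\<forall>x\<in>H. - x \<in> H)"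

text \<open>The term \<open>((+) x ^^ n) 0\<close> is the multiple \<open>x + \<dots> + x\<close> with \<open>n\<close> summands.\<close>

definition has_finite_order :: "'a::group_add \<Rightarrow> bool"
  where "has_finite_order x \<longleftrightarrow> (\<exists>n>0. ((+) x ^^ n) 0 = 0)"

definition torsion_free :: "'a::group_add set \<Rightarrow> bool"
  where "torsion_free G \<longleftrightarrow> (\<forall>x\<in>G. has_finite_order x \<longrightarrow> x = 0)"

definition dense_separable_space :: "'a topology \<Rightarrow> bool"
  where "dense_separable_space X \<longleftrightarrow>
    (\<forall>D. D \<subseteq> topspace X \<and> X closure_of D = topspace X \<longrightarrow> separable_space (subtopology X D))"

definition dense_subgroup_separable :: "'a::topological_group_add set \<Rightarrow> bool"
  where "dense_subgroup_separable G \<longleftrightarrow>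
    (\<forall>H. H \<subseteq> G \<and> add_subgroup H \<and> top_of_set G closure_of H = G
      \<longrightarrow> separable_space (top_of_set H))"

end

theory Submission
  imports Defs
begin

text \<open>
  A compact group with only countably many continuous characters is metrizable, because characters
  separate points and hence embed the group into a countable power of the complex plane
  (\<open>countable_characters_embedding\<close>). So the point is to show that an uncountable group of characters
  yields a dense subgroup that is not separable.

  An uncountable abelian group contains an uncountable family \<open>I\<close> of nonzero elements such that
  disjoint subfamilies generate subgroups with trivial intersection
  (\<open>uncountable_independent_family\<close>). Apply this to the character group, and let \<open>H\<close> consist of all
  points at which all but countably many members of \<open>I\<close> take the value \<open>1\<close>; for a power of the circle
  and its coordinate projections, \<open>H\<close> is the usual \<open>\<Sigma>\<close>-product. A countable subset of \<open>H\<close> lies in the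
  kernel of some member of \<open>I\<close>, which is a proper closed subgroup, so \<open>H\<close> cannot be both dense and
  separable. It is dense because values of characters can be prescribed
  independently: if two groups \<open>D\<close> and \<open>E\<close> of characters meet trivially and \<open>z\<close> is a point, then all
  of \<open>D\<close> takes the value \<open>1\<close> at some point that no member of \<open>E\<close> distinguishes from \<open>z\<close>
  (\<open>independent_prescription\<close>). Given a neighbourhood of \<open>z\<close>, compactness supplies finitely
  many characters that detect it; let them generate \<open>E\<close>, and let \<open>D\<close> be generated by \<open>I\<close> without the
  countably many members that interact with \<open>E\<close>.

  Prescription rests on the orthogonality of characters. Trigonometric polynomials \<open>p\<close> with
  spectrum in \<open>D\<close> and \<open>q\<close> with spectrum in \<open>E\<close> are stochastically independent: the invariant mean of \<open>p q\<close>
  is the product of the means. Taking for \<open>p\<close> and \<open>q\<close> high powers of nonnegative bumps that peak at the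
  desired values shows that both bumps are large at a common point.

  That characters separate points (\<open>characters_separate_points\<close>) is the Peter-Weyl theorem for
  compact abelian groups. Its proof uses only the invariant mean on continuous functions, obtained by
  averaging over finitely many translates until the oscillation is small, and the commutative
  convolution algebra. The normalized even powers of a nonzero hermitian element converge
  uniformly to a nonzero hermitian idempotent (\<open>projection_of_hermitian\<close>). A nonzero
  hermitian idempotent has squared norm at least \<open>1\<close>, which makes minimal ones exist; and a
  minimal one is, up to a scalar, a character, since its translates must be proportional to it.
\<close>

section \<open>The invariant mean on continuous functions\<close>

text \<open>
  Averaging over the subset sums of a list, as an iteration of two-point averages: in this form
  composition of averages is concatenation of lists, and every translate by a list element keeps at
  least the weight \<open>1 / 2 ^ length as\<close>.
\<close>

primrec avg :: "'a list \<Rightarrow> ('a::ab_group_add \<Rightarrow> 'b::real_vector) \<Rightarrow> 'a \<Rightarrow> 'b" where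
  "avg [] f = f"
| "avg (a # as) f = (\<lambda>x. (1/2) *\<^sub>R (avg as f x + avg as f (x + a)))"

lemma avg_append: "avg (xs @ ys) f = avg xs (avg ys f)"
  by (induction xs) auto

lemma avg_translate: "avg xs (\<lambda>x. f (x + a)) x = avg xs f (x + a)"
  by (induction xs arbitrary: x) (auto simp: algebra_simps)

lemma avg_add: "avg xs (\<lambda>x. f x + g x) x = avg xs f x + avg xs g x"
  by (induction xs arbitrary: x) (auto simp: algebra_simps)

lemma avg_linear: "linear L \<Longrightarrow> avg xs (\<lambda>x. L (f x)) x = L (avg xs f x)"
  by (induction xs arbitrary: x) (auto simp: linear_add linear_scale)

lemma avg_commute: "avg xs (avg ys f) = avg ys (avg xs f)"
proof (induction ys)
  case (Cons a ys)
  show ?case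
  proof
    fix x
    have "avg xs (avg (a # ys) f) x
        = (1/2) *\<^sub>R avg xs (\<lambda>x. avg ys f x + avg ys f (x + a)) x"
      using avg_linear[of "\<lambda>v::'b. (1/2) *\<^sub>R v" xs "\<lambda>x. avg ys f x + avg ys f (x + a)" x]
      by (simp add: bounded_linear.linear[OF bounded_linear_scaleR_right])
    then show "avg xs (avg (a # ys) f) x = avg (a # ys) (avg xs f) x"
      by (simp add: avg_add avg_translate Cons.IH)
  qed
qed simp

lemma avg_uminus_arg: "avg xs (\<lambda>x. f (- x)) x = avg (map uminus xs) f (- x)"
proof (induction xs arbitrary: x)
  case (Cons a xs)
  have "- (x + a) = - x + - a" by simp
  then show ?case by (simp only: avg.simps list.map Cons.IH)
qed simp

lemma avg_le:
  fixes f :: "'a::ab_group_add \<Rightarrow> real"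
  shows "(\<And>x. f x \<le> c) \<Longrightarrow> avg xs f x \<le> c"
proof (induction xs arbitrary: x)
  case (Cons a xs)
  from Cons.IH[OF Cons.prems, of x] Cons.IH[OF Cons.prems, of "x + a"] show ?case by simp
qed simp

lemma avg_uminus:
  fixes f :: "'a::ab_group_add \<Rightarrow> real"
  shows "avg xs (\<lambda>x. - f x) x = - avg xs f x"
  by (rule avg_linear) (simp add: linear_uminus)

lemma avg_ge:
  fixes f :: "'a::ab_group_add \<Rightarrow> real"
  shows "(\<And>x. c \<le> f x) \<Longrightarrow> c \<le> avg xs f x"
  using avg_le[of "\<lambda>x. - f x" "- c" xs x] by (simp add: avg_uminus)

lemma avg_norm_le:
  fixes f :: "'a::ab_group_add \<Rightarrow> 'b::real_normed_vector"
  shows "(\<And>x. norm (f x - c) \<le> e) \<Longrightarrow> norm (avg xs f x - c) \<le> e"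
proof (induction xs arbitrary: x)
  case (Cons a xs)
  have "avg (a # xs) f x - c = (1/2) *\<^sub>R ((avg xs f x - c) + (avg xs f (x + a) - c))"
    by (simp add: algebra_simps flip: scaleR_2)
  also have "norm \<dots> \<le> (1/2) * (e + e)"
    unfolding norm_scaleR
    using norm_triangle_mono[OF Cons.IH[OF Cons.prems, of x] Cons.IH[OF Cons.prems, of "x + a"]]
    by simp
  finally show ?case by simp
qed simp

lemma avg_le_at:
  fixes h :: "'a::ab_group_add \<Rightarrow> real"
  assumes "\<And>x. h x \<le> M" "h x \<le> M - d"
  shows "avg as h x \<le> M - d / 2 ^ length as"
proof (induction as)
  case (Cons a as)
  have "d / 2 ^ length (a # as) = (d / 2 ^ length as) / 2" by simp
  with Cons avg_le[of h M as "x + a", OF assms(1)] show ?case by simp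
qed (use assms in simp)

text \<open>
  One small value of \<open>h\<close> at a translate by an element of the list pushes the average below the
  upper bound by an amount that depends only on the length of the list.
\<close>

lemma avg_le_at_shift:
  fixes h :: "'a::ab_group_add \<Rightarrow> real"
  assumes "\<And>x. h x \<le> M" "a \<in> set as" "h (x + a) \<le> M - d"
  shows "avg as h x \<le> M - d / 2 ^ length as"
  using assms(2)
proof (induction as)
  case (Cons b as)
  have *: "avg as h x \<le> M" "avg as h (x + b) \<le> M"
    using avg_le[of h M, OF assms(1)] by auto
  have "avg as h x \<le> M - d / 2 ^ length as \<or> avg as h (x + b) \<le> M - d / 2 ^ length as"
    using Cons avg_le_at[of h M "x + a" d as, OF assms(1,3)] by auto
  moreover have "d / 2 ^ length (b # as) = (d / 2 ^ length as) / 2" by simp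
  ultimately show ?case using * by auto
qed simp

text \<open>
  A value that averages of translates approximate uniformly. Because averages commute, such a value
  is unique, and any two functions can be averaged by a common list.
\<close>

definition has_mean :: "('a::ab_group_add \<Rightarrow> 'b::real_normed_vector) \<Rightarrow> 'b \<Rightarrow> bool" where
  "has_mean f c \<longleftrightarrow> (\<forall>e>0. \<exists>xs. \<forall>x. norm (avg xs f x - c) \<le> e)"

lemma has_meanD:
  assumes "has_mean f c" "e > 0"
  obtains xs where "\<And>x. norm (avg xs f x - c) \<le> e"
  using assms unfolding has_mean_def by blast

lemma has_mean_common:
  assumes f: "\<And>x. norm (avg xs f x - c) \<le> e" and g: "\<And>x. norm (avg ys g x - d) \<le> e'"
  shows "norm (avg (xs @ ys) f x - c) \<le> e" "norm (avg (xs @ ys) g x - d) \<le> e'"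
  using avg_norm_le[of "avg xs f" c e ys, OF f] avg_norm_le[of "avg ys g" d e' xs, OF g]
  by (simp_all add: avg_append avg_commute)

lemma has_mean_unique:
  assumes "has_mean f c" "has_mean f d"
  shows "c = d"
proof (rule ccontr)
  assume "c \<noteq> d"
  then have e: "norm (c - d) / 3 > 0" by simp
  obtain xs where xs: "\<And>x. norm (avg xs f x - c) \<le> norm (c - d) / 3"
    using has_meanD[OF assms(1) e] by blast
  obtain ys where ys: "\<And>x. norm (avg ys f x - d) \<le> norm (c - d) / 3"
    using has_meanD[OF assms(2) e] by blast
  have "norm (c - d) \<le> norm (avg (xs @ ys) f 0 - c) + norm (avg (xs @ ys) f 0 - d)"
    by (metis dist_norm dist_triangle3)
  with has_mean_common[of xs f c _ ys f d, OF xs ys, of 0] e show False by linarith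
qed

lemma has_mean_const: "has_mean (\<lambda>x. c) c"
  unfolding has_mean_def by (metis avg.simps(1) diff_self norm_zero order.strict_implies_order)

lemma has_mean_add:
  assumes "has_mean f c" "has_mean g d"
  shows "has_mean (\<lambda>x. f x + g x) (c + d)"
  unfolding has_mean_def
proof (intro allI impI)
  fix e :: real assume "e > 0"
  then have e: "e / 2 > 0" by simp
  obtain xs where xs: "\<And>x. norm (avg xs f x - c) \<le> e/2"
    using has_meanD[OF assms(1) e] by blast
  obtain ys where ys: "\<And>x. norm (avg ys g x - d) \<le> e/2"
    using has_meanD[OF assms(2) e] by blast
  have "norm (avg (xs @ ys) (\<lambda>x. f x + g x) x - (c + d)) \<le> e" for x
    using norm_triangle_mono[OF has_mean_common[of xs f c _ ys g d, OF xs ys, of x]]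
    by (simp add: avg_add algebra_simps)
  then show "\<exists>xs. \<forall>x. norm (avg xs (\<lambda>x. f x + g x) x - (c + d)) \<le> e" by blast
qed

lemma has_mean_sum:
  assumes "finite I" "\<And>i. i \<in> I \<Longrightarrow> has_mean (f i) (c i)"
  shows "has_mean (\<lambda>x. \<Sum>i\<in>I. f i x) (\<Sum>i\<in>I. c i)"
  using assms by (induction I) (auto simp: has_mean_const has_mean_add)

lemma has_mean_bounded_linear:
  assumes "bounded_linear L" "has_mean f c"
  shows "has_mean (\<lambda>x. L (f x)) (L c)"
  unfolding has_mean_def
proof (intro allI impI)
  fix e :: real assume "e > 0"
  obtain K where K: "K > 0" "\<And>v. norm (L v) \<le> norm v * K"
    using bounded_linear.pos_bounded[OF assms(1)] by auto
  obtain xs where xs: "\<And>x. norm (avg xs f x - c) \<le> e / K"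
    using has_meanD[OF assms(2), of "e / K"] \<open>e > 0\<close> K(1) by auto
  have lin: "linear L" using assms(1) by (rule bounded_linear.linear)
  have "norm (avg xs (\<lambda>x. L (f x)) x - L c) \<le> e" for x
  proof -
    have "norm (avg xs (\<lambda>x. L (f x)) x - L c) = norm (L (avg xs f x - c))"
      by (simp add: avg_linear[OF lin] linear_diff[OF lin])
    also have "\<dots> \<le> norm (avg xs f x - c) * K" by (rule K(2))
    also have "\<dots> \<le> e" using xs[of x] K(1) by (simp add: field_simps)
    finally show ?thesis .
  qed
  then show "\<exists>xs. \<forall>x. norm (avg xs (\<lambda>x. L (f x)) x - L c) \<le> e" by blast
qed

lemma has_mean_translate:
  assumes "has_mean f c"
  shows "has_mean (\<lambda>x. f (x + a)) c"
  using assms unfolding has_mean_def by (metis avg_translate)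

lemma has_mean_uminus_arg:
  assumes "has_mean f c"
  shows "has_mean (\<lambda>x. f (- x)) c"
  unfolding has_mean_def
proof (intro allI impI)
  fix e :: real assume "e > 0"
  obtain xs where "\<And>x. norm (avg xs f x - c) \<le> e"
    using has_meanD[OF assms \<open>e > 0\<close>] by blast
  then have "norm (avg (map uminus xs) (\<lambda>x. f (- x)) x - c) \<le> e" for x
    by (simp add: avg_uminus_arg o_def)
  then show "\<exists>xs. \<forall>x. norm (avg xs (\<lambda>x. f (- x)) x - c) \<le> e" by blast
qed

lemma has_mean_avg:
  assumes "has_mean f c"
  shows "has_mean (avg ys f) c"
  unfolding has_mean_def
proof (intro allI impI)
  fix e :: real assume "e > 0"
  obtain xs where xs: "\<And>x. norm (avg xs f x - c) \<le> e"
    using has_meanD[OF assms \<open>e > 0\<close>] by blast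
  have "norm (avg xs (avg ys f) x - c) \<le> e" for x
    using avg_norm_le[of "avg xs f" c e ys, OF xs] by (simp add: avg_commute)
  then show "\<exists>xs. \<forall>x. norm (avg xs (avg ys f) x - c) \<le> e" by blast
qed

lemma has_mean_norm_le:
  assumes "has_mean f c" "\<And>x. norm (f x - d) \<le> B"
  shows "norm (c - d) \<le> B"
proof (rule field_le_epsilon)
  fix e :: real assume "e > 0"
  obtain xs where xs: "\<And>x. norm (avg xs f x - c) \<le> e"
    using has_meanD[OF assms(1) \<open>e > 0\<close>] by blast
  have "norm (c - d) \<le> norm (avg xs f 0 - c) + norm (avg xs f 0 - d)"
    by (metis dist_norm dist_triangle3)
  with xs[of 0] avg_norm_le[of f d B xs 0, OF assms(2)] show "norm (c - d) \<le> B + e"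
    by simp
qed

lemma has_mean_ge:
  fixes f :: "'a::ab_group_add \<Rightarrow> real"
  assumes "has_mean f c" "\<And>x. d \<le> f x"
  shows "d \<le> c"
proof (rule field_le_epsilon)
  fix e :: real assume "e > 0"
  obtain xs where xs: "\<And>x. norm (avg xs f x - c) \<le> e"
    using has_meanD[OF assms(1) \<open>e > 0\<close>] by blast
  from avg_ge[of d f xs 0, OF assms(2)] xs[of 0] show "d \<le> c + e"
    by (simp add: abs_le_iff)
qed

definition mean :: "('a::ab_group_add \<Rightarrow> 'b::real_normed_vector) \<Rightarrow> 'b" where
  "mean f = (THE c. has_mean f c)"

lemma mean_eqI: "has_mean f c \<Longrightarrow> mean f = c"
  unfolding mean_def using has_mean_unique by blast

lemma continuous_on_shift:
  fixes f :: "'a::topological_ab_group_add \<Rightarrow> 'b::topological_space"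
  assumes "continuous_on UNIV f"
  shows "continuous_on UNIV (\<lambda>x. f (x + a))"
  by (rule continuous_on_compose2[OF assms]) (auto intro!: continuous_intros)

locale compact_ab_group =
  fixes G :: "'a::{topological_ab_group_add, t2_space} itself"
  assumes compact_UNIV: "compact (UNIV :: 'a set)"
begin

lemma finite_translates_cover:
  fixes V :: "'a set"
  assumes "open V" "v \<in> V"
  obtains as where "\<And>x. \<exists>a\<in>set as. x + a \<in> V"
proof -
  have op: "open ((\<lambda>x. x + a) -` V)" if "a \<in> UNIV" for a
    by (rule open_vimage[OF assms(1)]) (auto intro!: continuous_intros)
  have cov: "UNIV \<subseteq> (\<Union>a\<in>UNIV. (\<lambda>x. x + a) -` V)"
  proof
    fix x
    have "x + (v - x) \<in> V" using assms(2) by simp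
    then show "x \<in> (\<Union>a\<in>UNIV. (\<lambda>x. x + a) -` V)" by blast
  qed
  obtain C where "C \<subseteq> UNIV" and C: "finite C" "UNIV \<subseteq> (\<Union>a\<in>C. (\<lambda>x. x + a) -` V)"
    by (rule compactE_image[OF compact_UNIV op cov])
  obtain as where "set as = C" using C(1) finite_list by blast
  with C(2) show ?thesis by (intro that[of as]) auto
qed

lemma uniformly_continuous:
  fixes f :: "'a \<Rightarrow> 'b::metric_space"
  assumes "continuous_on UNIV f" "e > 0"
  obtains V where "open V" "0 \<in> V" "\<And>x v. v \<in> V \<Longrightarrow> dist (f (x + v)) (f x) \<le> e"
proof -
  have "continuous_on (UNIV \<times> UNIV) (\<lambda>(v, x). f (x + v))"
    by (auto simp: split_beta intro!: continuous_on_compose2[OF assms(1)] continuous_intros)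
  from continuous_on_prod_compactE[OF this compact_UNIV UNIV_I assms(2), of 0]
  obtain V where V: "0 \<in> V" "open V"
      "\<forall>v\<in>V \<inter> UNIV. \<forall>x\<in>UNIV. dist ((\<lambda>(v, x). f (x + v)) (v, x)) ((\<lambda>(v, x). f (x + v)) (0, x)) \<le> e"
    by metis
  show ?thesis by (rule that[OF V(2,1)]) (use V(3) in simp)
qed

lemma bounded_continuous:
  fixes f :: "'a \<Rightarrow> 'b::real_normed_vector"
  assumes "continuous_on UNIV f"
  obtains B where "B > 0" "\<And>x. norm (f x) \<le> B"
  using compact_imp_bounded[OF compact_continuous_image[OF assms compact_UNIV]]
  by (auto simp: bounded_pos)

text \<open>
  Von Neumann's argument. By uniform continuity all averages of \<open>f\<close> share one modulus of
  continuity. So if an average still oscillates by more than \<open>e\<close>, its values are low on a whole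
  translate of a fixed neighbourhood \<open>V\<close> of \<open>0\<close>, and averaging over a list whose translates of \<open>V\<close> cover
  the group lowers the maximum by a fixed amount \<open>\<delta>\<close>. This can happen only finitely often.
\<close>

lemma avg_oscillation:
  fixes f :: "'a \<Rightarrow> real"
  assumes f: "continuous_on UNIV f" and e: "e > 0"
  shows "\<exists>ys m. \<forall>x. m \<le> avg ys f x \<and> avg ys f x \<le> m + e"
proof -
  define P where "P D \<longleftrightarrow> (\<exists>ys m. \<forall>x. m \<le> avg ys f x \<and> avg ys f x \<le> m + D)" for D
  define r where "r = e / 3"
  have r: "r > 0" "e = 3 * r" using e by (simp_all add: r_def)
  obtain V where V: "open V" "0 \<in> V" "\<And>x v. v \<in> V \<Longrightarrow> dist (f (x + v)) (f x) \<le> r"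
    using uniformly_continuous[OF f r(1)] by blast
  obtain as where as: "\<And>x. \<exists>a\<in>set as. x + a \<in> V"
    using finite_translates_cover[OF V(1,2)] by blast
  have avg_V: "\<bar>avg ys f (x + v) - avg ys f x\<bar> \<le> r" if "v \<in> V" for ys x v
  proof -
    have "avg ys (\<lambda>x. f (x + v) + (- f x)) x = avg ys f (x + v) - avg ys f x"
      unfolding avg_add by (simp add: avg_translate avg_uminus)
    moreover have "norm (avg ys (\<lambda>x. f (x + v) + (- f x)) x - 0) \<le> r"
      by (rule avg_norm_le) (use V(3)[OF that] in \<open>simp add: dist_real_def\<close>)
    ultimately show ?thesis by simp
  qed
  define \<delta> where "\<delta> = r / 2 ^ length as"
  have \<delta>: "\<delta> > 0" "\<delta> \<le> r" using r(1) by (simp_all add: \<delta>_def field_simps)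
  have step: "P (D - \<delta>)" if PD: "P D" and D: "D > e" for D
  proof -
    obtain ys m where ys: "\<And>x. m \<le> avg ys f x" "\<And>x. avg ys f x \<le> m + D"
      using PD unfolding P_def by blast
    show ?thesis
    proof (cases "\<forall>x. m + \<delta> \<le> avg ys f x")
      case True
      then show ?thesis unfolding P_def using ys(2)
        by (intro exI[of _ ys] exI[of _ "m + \<delta>"]) auto
    next
      case False
      then obtain q where q: "avg ys f q < m + \<delta>" by (auto simp: not_le)
      have "avg as (avg ys f) x \<le> (m + D) - r / 2 ^ length as" for x
      proof -
        obtain a where a: "a \<in> set as" "(x - q) + a \<in> V" using as by blast
        have "avg ys f (x + a) \<le> avg ys f q + r"
          using avg_V[OF a(2), of ys q] by (simp add: algebra_simps abs_le_iff)
        then have "avg ys f (x + a) \<le> (m + D) - r" using q \<delta> D r by simp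
        then show ?thesis using avg_le_at_shift[of "avg ys f", OF ys(2) a(1)] by blast
      qed
      then show ?thesis unfolding P_def
        using avg_ge[of m "avg ys f", OF ys(1)]
        by (intro exI[of _ "as @ ys"] exI[of _ m]) (auto simp: avg_append \<delta>_def algebra_simps)
    qed
  qed
  have mono: "P D'" if "P D" "D \<le> D'" for D D'
    using that unfolding P_def by (meson add_left_mono order_trans)
  have "P e"
  proof -
    obtain B where B: "B > 0" "\<And>x. norm (f x) \<le> B" using bounded_continuous[OF f] by blast
    have P0: "P (2 * B)" unfolding P_def
      by (intro exI[of _ "[]"] exI[of _ "-B"]) (use B(2) in \<open>auto simp: abs_le_iff minus_le_iff\<close>)
    have iter: "P (max e (2 * B - real n * \<delta>))" for n
    proof (induction n)
      case 0
      show ?case by (rule mono[OF P0]) simp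
    next
      case (Suc n)
      show ?case
      proof (cases "2 * B - real n * \<delta> > e")
        case True
        then have "P ((2 * B - real n * \<delta>) - \<delta>)" using Suc step by (simp add: max_def)
        then show ?thesis by (rule mono) (simp add: algebra_simps)
      next
        case False
        then have "P e" using Suc by (simp add: max_def split: if_splits)
        then show ?thesis by (rule mono) simp
      qed
    qed
    obtain n where "2 * B < real n * \<delta>" using reals_Archimedean3[OF \<delta>(1)] by blast
    then show ?thesis using iter[of n] e by (simp add: max_def split: if_splits)
  qed
  then show ?thesis unfolding P_def .
qed

text \<open>
  The lower bounds of all averages are dominated by the upper bounds of all averages, by commuting
  two averages; small oscillation closes the gap.
\<close>

lemma has_mean_exists_real:
  fixes f :: "'a \<Rightarrow> real"
  assumes f: "continuous_on UNIV f"
  shows "\<exists>c. has_mean f c"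
proof -
  define S where "S = {m. \<exists>ys. \<forall>x. m \<le> avg ys f x}"
  have le: "m' \<le> M" if "m' \<in> S" "\<And>x. avg ys f x \<le> M" for m' M ys
  proof -
    obtain zs where zs: "\<And>x. m' \<le> avg zs f x" using \<open>m' \<in> S\<close> unfolding S_def by blast
    have "m' \<le> avg ys (avg zs f) 0" by (rule avg_ge) (rule zs)
    also have "\<dots> \<le> M" by (subst avg_commute) (rule avg_le, rule that(2))
    finally show ?thesis .
  qed
  have "has_mean f (Sup S)" unfolding has_mean_def
  proof (intro allI impI)
    fix e :: real assume "e > 0"
    obtain ys m where ys: "\<And>x. m \<le> avg ys f x" "\<And>x. avg ys f x \<le> m + e"
      using avg_oscillation[OF f \<open>e > 0\<close>] by blast
    have "m \<in> S" unfolding S_def using ys(1) by blast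
    moreover have bd: "m' \<le> m + e" if "m' \<in> S" for m' using le[OF that ys(2)] .
    ultimately have "m \<le> Sup S" "Sup S \<le> m + e"
      by (auto intro!: cSup_upper cSup_least bdd_aboveI[of _ "m + e"])
    then have "norm (avg ys f x - Sup S) \<le> e" for x
      using ys[of x] by (simp add: abs_le_iff)
    then show "\<exists>xs. \<forall>x. norm (avg xs f x - Sup S) \<le> e" by blast
  qed
  then show ?thesis ..
qed

lemma has_mean_mean:
  fixes f :: "'a \<Rightarrow> 'b::euclidean_space"
  assumes f: "continuous_on UNIV f"
  shows "has_mean f (mean f)"
proof -
  have "\<exists>c. has_mean (\<lambda>x. f x \<bullet> b) c" for b
    by (rule has_mean_exists_real) (intro continuous_intros f)
  then obtain c where c: "\<And>b. has_mean (\<lambda>x. f x \<bullet> b) (c b)" by metis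
  have "has_mean (\<lambda>x. \<Sum>b\<in>Basis. (f x \<bullet> b) *\<^sub>R b) (\<Sum>b\<in>Basis. c b *\<^sub>R b)"
    by (intro has_mean_sum finite_Basis has_mean_bounded_linear[OF bounded_linear_scaleR_left] c)
  then have "has_mean f (\<Sum>b\<in>Basis. c b *\<^sub>R b)" by (simp add: euclidean_representation)
  then show ?thesis using mean_eqI by metis
qed

lemma mean_add:
  fixes f g :: "'a \<Rightarrow> 'b::euclidean_space"
  assumes "continuous_on UNIV f" "continuous_on UNIV g"
  shows "mean (\<lambda>x. f x + g x) = mean f + mean g"
  by (intro mean_eqI has_mean_add has_mean_mean assms)

lemma mean_bounded_linear:
  fixes f :: "'a \<Rightarrow> 'b::euclidean_space"
  assumes "bounded_linear L" "continuous_on UNIV f"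
  shows "mean (\<lambda>x. L (f x)) = L (mean f)"
  by (rule mean_eqI[OF has_mean_bounded_linear[OF assms(1) has_mean_mean[OF assms(2)]]])

lemma mean_diff:
  fixes f g :: "'a \<Rightarrow> 'b::euclidean_space"
  assumes "continuous_on UNIV f" "continuous_on UNIV g"
  shows "mean (\<lambda>x. f x - g x) = mean f - mean g"
  using mean_add[OF assms(1), of "\<lambda>x. - g x"] assms
    mean_bounded_linear[OF bounded_linear_minus[OF bounded_linear_ident], of g]
  by (simp add: continuous_on_minus)

lemma mean_translate:
  fixes f :: "'a \<Rightarrow> 'b::euclidean_space"
  assumes "continuous_on UNIV f"
  shows "mean (\<lambda>x. f (x + a)) = mean f"
  by (intro mean_eqI has_mean_translate has_mean_mean assms)

lemma mean_reflect:
  fixes f :: "'a \<Rightarrow> 'b::euclidean_space"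
  assumes "continuous_on UNIV f"
  shows "mean (\<lambda>x. f (a - x)) = mean f"
proof -
  have "has_mean (\<lambda>x. f (- x + a)) (mean f)"
    by (rule has_mean_uminus_arg[OF has_mean_translate[OF has_mean_mean[OF assms]]])
  then show ?thesis by (simp add: mean_eqI)
qed

lemma mean_norm_le:
  fixes f :: "'a \<Rightarrow> 'b::euclidean_space"
  assumes "continuous_on UNIV f" "\<And>x. norm (f x - d) \<le> B"
  shows "norm (mean f - d) \<le> B"
  by (rule has_mean_norm_le[OF has_mean_mean[OF assms(1)] assms(2)])

lemma mean_ge:
  fixes f :: "'a \<Rightarrow> real"
  assumes "continuous_on UNIV f" "\<And>x. d \<le> f x"
  shows "d \<le> mean f"
  by (rule has_mean_ge[OF has_mean_mean[OF assms(1)] assms(2)])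

text \<open>
  The set where \<open>p > t\<close> has finitely many translates covering the group, so the average of
  \<open>p ^ n\<close> over these translates is at least a fixed multiple of \<open>t ^ n\<close>. For \<open>n = 1\<close> this is the
  strict positivity of the mean.
\<close>

lemma mean_power_ge:
  fixes p :: "'a \<Rightarrow> real"
  assumes p: "continuous_on UNIV p" "\<And>x. 0 \<le> p x" and t: "0 \<le> t" "t < p z"
  obtains c where "c > 0" "\<And>n. c * t ^ n \<le> mean (\<lambda>x. p x ^ n)"
proof -
  have "open (p -` {t<..})" by (rule open_vimage[OF open_greaterThan p(1)])
  then obtain as where as: "\<And>x. \<exists>a\<in>set as. x + a \<in> p -` {t<..}"
    using finite_translates_cover[of "p -` {t<..}" z] t by auto
  define c where "c = (1 / 2 ^ length as :: real)"
  have "c * t ^ n \<le> mean (\<lambda>x. p x ^ n)" for n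
  proof -
    have cont: "continuous_on UNIV (\<lambda>x. p x ^ n)" by (intro continuous_intros p(1))
    have "c * t ^ n \<le> avg as (\<lambda>x. p x ^ n) x" for x
    proof -
      obtain a where a: "a \<in> set as" "t < p (x + a)" using as by auto
      have "avg as (\<lambda>x. - (p x ^ n)) x \<le> 0 - t ^ n / 2 ^ length as"
        by (rule avg_le_at_shift[OF _ a(1)])
          (use p(2) power_mono[of t "p (x + a)" n] t(1) a(2) in auto)
      then show ?thesis by (simp add: avg_uminus c_def)
    qed
    then show ?thesis
      using has_mean_ge[OF has_mean_avg[OF has_mean_mean[OF cont]]] by blast
  qed
  then show ?thesis by (intro that[of c]) (auto simp: c_def)
qed

lemma tube:
  fixes F :: "'a \<Rightarrow> 'a \<Rightarrow> 'b::real_normed_vector"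
  assumes "continuous_on UNIV (\<lambda>p. F (fst p) (snd p))" "e > 0"
  obtains X where "open X" "x \<in> X" "\<And>x' y. x' \<in> X \<Longrightarrow> norm (F x' y - F x y) \<le> e"
proof -
  have "continuous_on (UNIV \<times> UNIV) (\<lambda>p. F (fst p) (snd p))" using assms(1) by simp
  from continuous_on_prod_compactE[OF this compact_UNIV UNIV_I assms(2), of x]
  obtain X where X: "x \<in> X" "open X"
      "\<forall>x'\<in>X \<inter> UNIV. \<forall>y\<in>UNIV. dist (F (fst (x', y)) (snd (x', y))) (F (fst (x, y)) (snd (x, y))) \<le> e"
    by metis
  show ?thesis by (rule that[OF X(2,1)]) (use X(3) in \<open>simp add: dist_norm\<close>)
qed

lemma continuous_section:
  assumes "continuous_on UNIV (\<lambda>p. F (fst p) (snd p))"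
  shows "continuous_on UNIV (F x)" "continuous_on UNIV (\<lambda>x. F x y)"
proof -
  have "continuous_on UNIV (\<lambda>y. (x, y))" "continuous_on UNIV (\<lambda>x. (x, y))"
    by (intro continuous_intros)+
  from this[THEN continuous_on_compose2[OF assms]]
  show "continuous_on UNIV (F x)" "continuous_on UNIV (\<lambda>x. F x y)" by simp_all
qed

lemma continuous_on_mean:
  fixes F :: "'a \<Rightarrow> 'a \<Rightarrow> 'b::euclidean_space"
  assumes F: "continuous_on UNIV (\<lambda>p. F (fst p) (snd p))"
  shows "continuous_on UNIV (\<lambda>x. mean (F x))"
  unfolding continuous_on_topological
proof (intro ballI allI impI)
  fix x B assume "open B" "mean (F x) \<in> B"
  then obtain e where e: "e > 0" "ball (mean (F x)) e \<subseteq> B" by (meson open_contains_ball)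
  then have "e / 2 > 0" by simp
  then obtain X where X: "open X" "x \<in> X" "\<And>x' y. x' \<in> X \<Longrightarrow> norm (F x' y - F x y) \<le> e / 2"
    using tube[OF F] by metis
  have "mean (F x') \<in> B" if "x' \<in> X" for x'
  proof -
    have "norm (mean (\<lambda>y. F x' y - F x y) - 0) \<le> e / 2"
      by (rule mean_norm_le) (use X(3)[OF that] in \<open>auto intro!: continuous_intros continuous_section[OF F]\<close>)
    then have "norm (mean (F x') - mean (F x)) \<le> e / 2"
      by (simp add: mean_diff continuous_section[OF F])
    then have "mean (F x') \<in> ball (mean (F x)) e"
      using e(1) by (simp add: dist_norm norm_minus_commute)
    then show ?thesis using e(2) by blast
  qed
  with X show "\<exists>A. open A \<and> x \<in> A \<and> (\<forall>y\<in>UNIV. y \<in> A \<longrightarrow> mean (F y) \<in> B)" by blast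
qed

text \<open>
  Averages that are good for finitely many functions are good for all sections of \<open>F\<close>, since up to a
  small error the sections form a finite set by compactness.
\<close>

lemma uniform_avg:
  fixes F :: "'a \<Rightarrow> 'a \<Rightarrow> 'b::euclidean_space"
  assumes F: "continuous_on UNIV (\<lambda>p. F (fst p) (snd p))" and e: "e > 0"
  obtains ys where "\<And>x y. norm (avg ys (F x) y - mean (F x)) \<le> e"
proof -
  have "e / 3 > 0" using e by simp
  then have "\<exists>X. open X \<and> x \<in> X \<and> (\<forall>x'\<in>X. \<forall>y. norm (F x' y - F x y) \<le> e / 3)" for x
    by (rule tube[OF F, of _ x]) blast
  then obtain X where X: "\<And>x. open (X x)" "\<And>x. x \<in> X x"
      "\<And>x x' y. x' \<in> X x \<Longrightarrow> norm (F x' y - F x y) \<le> e / 3"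
    by metis
  have cov: "UNIV \<subseteq> (\<Union>x\<in>UNIV. X x)" using X(2) by blast
  obtain C where "C \<subseteq> UNIV" and C: "finite C" "UNIV \<subseteq> (\<Union>x\<in>C. X x)"
    by (rule compactE_image[OF compact_UNIV X(1) cov])
  have "\<exists>ys. \<forall>x\<in>C. \<forall>y. norm (avg ys (F x) y - mean (F x)) \<le> e / 3"
    using C(1)
  proof induction
    case (insert z C)
    then obtain ys where ys: "\<forall>x\<in>C. \<forall>y. norm (avg ys (F x) y - mean (F x)) \<le> e / 3" by blast
    obtain zs where zs: "\<And>y. norm (avg zs (F z) y - mean (F z)) \<le> e / 3"
      using has_meanD[OF has_mean_mean[OF continuous_section(1)[OF F]] \<open>e / 3 > 0\<close>] by blast
    have "norm (avg (zs @ ys) (F x) y - mean (F x)) \<le> e / 3" if "x \<in> insert z C" for x y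
    proof (cases "x = z")
      case True
      then show ?thesis
        using avg_norm_le[of "avg zs (F z)" "mean (F z)" "e/3" ys, OF zs]
        by (simp add: avg_append avg_commute[of zs])
    next
      case False
      then have "norm (avg ys (F x) y - mean (F x)) \<le> e / 3" for y using ys that by blast
      then show ?thesis unfolding avg_append by (rule avg_norm_le)
    qed
    then show ?case by blast
  qed simp
  then obtain ys where ys: "\<And>x y. x \<in> C \<Longrightarrow> norm (avg ys (F x) y - mean (F x)) \<le> e / 3" by blast
  have "norm (avg ys (F x) y - mean (F x)) \<le> e" for x y
  proof -
    obtain z where z: "z \<in> C" "x \<in> X z" using C(2) by blast
    have d: "norm (F x y - F z y) \<le> e / 3" for y using X(3)[OF z(2)] .
    have lin: "linear (uminus :: 'b \<Rightarrow> 'b)" by (simp add: linear_uminus)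
    have "avg ys (\<lambda>y. F x y + - F z y) y = avg ys (F x) y - avg ys (F z) y"
      unfolding avg_add using avg_linear[OF lin, of ys "F z" y] by simp
    moreover have "norm (avg ys (\<lambda>y. F x y + - F z y) y - 0) \<le> e / 3"
      by (rule avg_norm_le) (use d in simp)
    ultimately have 1: "norm (avg ys (F x) y - avg ys (F z) y) \<le> e / 3" by simp
    have "norm (mean (\<lambda>y. F x y - F z y) - 0) \<le> e / 3"
      by (rule mean_norm_le) (use d in \<open>auto intro!: continuous_intros continuous_section[OF F]\<close>)
    then have 2: "norm (mean (F z) - mean (F x)) \<le> e / 3"
      by (simp add: mean_diff continuous_section[OF F] norm_minus_commute)
    have "avg ys (F x) y - mean (F x) = (avg ys (F x) y - avg ys (F z) y)
        + (avg ys (F z) y - mean (F z)) + (mean (F z) - mean (F x))" by simp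
    also have "norm \<dots> \<le> e / 3 + e / 3 + e / 3"
      by (intro norm_triangle_mono 1 2 ys z)
    finally show ?thesis by simp
  qed
  then show ?thesis using that by blast
qed

text \<open>
  Fubini's theorem: a finite average in one variable commutes with the mean in the other, and by
  uniformity it approximates the iterated mean.
\<close>

lemma mean_swap:
  fixes F :: "'a \<Rightarrow> 'a \<Rightarrow> 'b::euclidean_space"
  assumes F: "continuous_on UNIV (\<lambda>p. F (fst p) (snd p))"
  shows "mean (\<lambda>x. mean (\<lambda>y. F x y)) = mean (\<lambda>y. mean (\<lambda>x. F x y))"
proof (rule sym, rule mean_eqI, unfold has_mean_def, intro allI impI)
  fix e :: real assume "e > 0"
  then obtain ys where ys: "\<And>x y. norm (avg ys (F x) y - mean (F x)) \<le> e"
    using uniform_avg[OF F] by blast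
  have avg_mean: "avg ys (\<lambda>y. mean (\<lambda>x. F x y)) y = mean (\<lambda>x. avg ys (F x) y)
      \<and> continuous_on UNIV (\<lambda>x. avg ys (F x) y)" for ys y
  proof (induction ys arbitrary: y)
    case (Cons a ys)
    have cont: "continuous_on UNIV (\<lambda>x. avg ys (F x) y)" for y using Cons by blast
    then have cont': "continuous_on UNIV (\<lambda>x. avg ys (F x) y + avg ys (F x) (y + a))"
      by (intro continuous_on_add)
    show ?case
      using mean_bounded_linear[OF bounded_linear_scaleR_right cont', of "1/2"]
        mean_add[OF cont cont] Cons cont'
      by (simp add: continuous_on_scaleR)
  qed (auto intro!: continuous_section[OF F])
  have "norm (avg ys (\<lambda>y. mean (\<lambda>x. F x y)) y - mean (\<lambda>x. mean (\<lambda>y. F x y))) \<le> e" for y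
  proof -
    have "norm (mean (\<lambda>x. avg ys (F x) y - mean (F x)) - 0) \<le> e"
      by (rule mean_norm_le)
        (use ys avg_mean[of ys y] continuous_on_mean[OF F] in \<open>auto intro!: continuous_intros\<close>)
    then show ?thesis
      using avg_mean[of ys y] continuous_on_mean[OF F] by (simp add: mean_diff)
  qed
  then show "\<exists>ys. \<forall>y. norm (avg ys (\<lambda>y. mean (\<lambda>x. F x y)) y - mean (\<lambda>x. mean (\<lambda>y. F x y))) \<le> e"
    by blast
qed

end

section \<open>The convolution algebra\<close>

definition conv :: "('a::ab_group_add \<Rightarrow> complex) \<Rightarrow> ('a \<Rightarrow> complex) \<Rightarrow> 'a \<Rightarrow> complex" where
  "conv f g = (\<lambda>x. mean (\<lambda>y. f (x - y) * g y))"

definition star :: "('a::ab_group_add \<Rightarrow> complex) \<Rightarrow> 'a \<Rightarrow> complex" where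
  "star f = (\<lambda>x. cnj (f (- x)))"

definition sqnorm :: "('a::ab_group_add \<Rightarrow> complex) \<Rightarrow> real" where
  "sqnorm f = mean (\<lambda>x. (cmod (f x))\<^sup>2)"

text \<open>
  Convolution by such a function is an orthogonal projection, with range spanned by the characters
  in its spectrum.
\<close>

definition is_projection :: "('a::topological_ab_group_add \<Rightarrow> complex) \<Rightarrow> bool" where
  "is_projection e \<longleftrightarrow> continuous_on UNIV e \<and> star e = e \<and> conv e e = e"

definition is_character :: "('a::topological_ab_group_add \<Rightarrow> complex) \<Rightarrow> bool" where
  "is_character \<phi> \<longleftrightarrow> continuous_on UNIV \<phi> \<and> (\<forall>x y. \<phi> (x + y) = \<phi> x * \<phi> y) \<and> (\<forall>x. cmod (\<phi> x) = 1)"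

lemma continuous_on_star:
  fixes f :: "'a::topological_ab_group_add \<Rightarrow> complex"
  assumes "continuous_on UNIV f"
  shows "continuous_on UNIV (star f)"
  unfolding star_def by (intro continuous_intros continuous_on_compose2[OF assms]) auto

context compact_ab_group
begin

lemma continuous_conv_kernel:
  fixes f g :: "'a \<Rightarrow> complex"
  assumes "continuous_on UNIV f" "continuous_on UNIV g"
  shows "continuous_on UNIV (\<lambda>p. f (fst p - snd p) * g (snd p))"
  by (intro continuous_intros continuous_on_compose2[OF assms(1)] continuous_on_compose2[OF assms(2)]) auto

lemma continuous_conv_arg:
  fixes f g :: "'a \<Rightarrow> complex"
  assumes "continuous_on UNIV f" "continuous_on UNIV g"
  shows "continuous_on UNIV (\<lambda>y. f (x - y) * g y)"
  by (intro continuous_intros continuous_on_compose2[OF assms(1)] assms(2)) auto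

lemma continuous_on_conv:
  fixes f g :: "'a \<Rightarrow> complex"
  assumes "continuous_on UNIV f" "continuous_on UNIV g"
  shows "continuous_on UNIV (conv f g)"
  unfolding conv_def by (rule continuous_on_mean) (rule continuous_conv_kernel[OF assms])

lemma conv_commute:
  fixes f g :: "'a \<Rightarrow> complex"
  assumes "continuous_on UNIV f" "continuous_on UNIV g"
  shows "conv f g = conv g f"
proof
  fix x
  show "conv f g x = conv g f x"
    using mean_reflect[OF continuous_conv_arg[OF assms(2,1)], of x x]
    by (simp add: conv_def mult.commute)
qed

lemma conv_assoc:
  fixes f g h :: "'a \<Rightarrow> complex"
  assumes f: "continuous_on UNIV f" and g: "continuous_on UNIV g" and h: "continuous_on UNIV h"
  shows "conv (conv f g) h = conv f (conv g h)"
proof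
  fix x
  have *: "conv f g (x - y) * h y = mean (\<lambda>w. f (x - w) * g (w - y) * h y)" for y
  proof -
    have "conv f g (x - y) = mean (\<lambda>w. f (x - y - (w + - y)) * g (w + - y))"
      unfolding conv_def by (rule mean_translate[OF continuous_conv_arg[OF f g], symmetric])
    then have "conv f g (x - y) * h y = mean (\<lambda>w. f (x - w) * g (w - y)) * h y" by simp
    also have "\<dots> = mean (\<lambda>w. f (x - w) * g (w - y) * h y)"
      by (rule mean_bounded_linear[OF bounded_linear_mult_left, symmetric])
        (intro continuous_intros continuous_on_compose2[OF f] continuous_on_compose2[OF g], auto)
    finally show ?thesis .
  qed
  have "conv (conv f g) h x = mean (\<lambda>y. mean (\<lambda>w. f (x - w) * g (w - y) * h y))"
    unfolding conv_def[of "conv f g"] by (simp add: *)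
  also have "\<dots> = mean (\<lambda>w. mean (\<lambda>y. f (x - w) * g (w - y) * h y))"
    by (rule mean_swap)
      (intro continuous_intros continuous_on_compose2[OF f] continuous_on_compose2[OF g]
        continuous_on_compose2[OF h], auto)
  also have "\<dots> = mean (\<lambda>w. f (x - w) * conv g h w)"
    unfolding conv_def
    using mean_bounded_linear[OF bounded_linear_mult_right continuous_conv_arg[OF g h]]
    by (simp add: mult.assoc)
  finally show "conv (conv f g) h x = conv f (conv g h) x" by (simp add: conv_def)
qed

lemma conv_add_right:
  fixes f g h :: "'a \<Rightarrow> complex"
  assumes "continuous_on UNIV f" "continuous_on UNIV g" "continuous_on UNIV h"
  shows "conv f (\<lambda>x. g x + h x) = (\<lambda>x. conv f g x + conv f h x)"
  using mean_add[OF continuous_conv_arg[OF assms(1,2)] continuous_conv_arg[OF assms(1,3)]]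
  by (simp add: conv_def ring_distribs)

lemma conv_scale_right:
  fixes f g :: "'a \<Rightarrow> complex"
  assumes "continuous_on UNIV f" "continuous_on UNIV g"
  shows "conv f (\<lambda>x. c * g x) = (\<lambda>x. c * conv f g x)"
  using mean_bounded_linear[OF bounded_linear_mult_right[of c] continuous_conv_arg[OF assms]]
  by (simp add: conv_def mult.left_commute)

lemma conv_diff_right:
  fixes f g h :: "'a \<Rightarrow> complex"
  assumes "continuous_on UNIV f" "continuous_on UNIV g" "continuous_on UNIV h"
  shows "conv f (\<lambda>x. g x - h x) = (\<lambda>x. conv f g x - conv f h x)"
  using mean_diff[OF continuous_conv_arg[OF assms(1,2)] continuous_conv_arg[OF assms(1,3)]]
  by (simp add: conv_def ring_distribs)

lemma conv_diff_left:
  fixes f g h :: "'a \<Rightarrow> complex"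
  assumes "continuous_on UNIV f" "continuous_on UNIV g" "continuous_on UNIV h"
  shows "conv (\<lambda>x. g x - h x) f = (\<lambda>x. conv g f x - conv h f x)"
  using conv_diff_right[OF assms] assms by (simp add: conv_commute[of _ f] continuous_intros)

lemma conv_scale_left:
  fixes f g :: "'a \<Rightarrow> complex"
  assumes "continuous_on UNIV f" "continuous_on UNIV g"
  shows "conv (\<lambda>x. c * g x) f = (\<lambda>x. c * conv g f x)"
  using conv_scale_right[OF assms] assms by (simp add: conv_commute[of _ f] continuous_intros)

lemma conv_zero_right: "conv f (\<lambda>x::'a. 0) = (\<lambda>x. 0)"
  by (simp add: conv_def mean_eqI[OF has_mean_const])

lemma conv_shift_left: "conv (\<lambda>x. f (x + a)) g = (\<lambda>x. conv f g (x + a))"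
  by (simp add: conv_def algebra_simps)

lemma conv_shift_right:
  fixes f g :: "'a \<Rightarrow> complex"
  assumes "continuous_on UNIV f" "continuous_on UNIV g"
  shows "conv f (\<lambda>x. g (x + a)) = (\<lambda>x. conv f g (x + a))"
  using conv_shift_left[of g a f] conv_commute[OF assms]
    conv_commute[OF assms(1) continuous_on_shift[OF assms(2)]] by simp

lemma star_conv:
  fixes f g :: "'a \<Rightarrow> complex"
  assumes "continuous_on UNIV f" "continuous_on UNIV g"
  shows "star (conv f g) = conv (star f) (star g)"
proof
  fix x
  have "star (conv f g) x = mean (\<lambda>y. cnj (f (- x - y) * g y))"
    unfolding star_def conv_def
    by (rule mean_bounded_linear[OF bounded_linear_cnj continuous_conv_arg[OF assms], symmetric])
  also have "\<dots> = mean (\<lambda>y. cnj (f (- x - (0 - y)) * g (0 - y)))"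
    by (rule mean_reflect[symmetric]) (intro continuous_on_cnj continuous_conv_arg[OF assms])
  finally show "star (conv f g) x = conv (star f) (star g) x"
    by (simp add: conv_def star_def)
qed

lemma star_star [simp]: "star (star f) = f"
  by (simp add: star_def)

lemma continuous_on_cmod_square:
  fixes f :: "'a \<Rightarrow> complex"
  assumes "continuous_on UNIV f"
  shows "continuous_on UNIV (\<lambda>x. (cmod (f x))\<^sup>2)"
  by (intro continuous_intros assms)

lemma sqnorm_eq_conv:
  fixes f :: "'a \<Rightarrow> complex"
  assumes "continuous_on UNIV f"
  shows "of_real (sqnorm f) = conv (star f) f 0"
proof -
  have "of_real (sqnorm f) = mean (\<lambda>x. of_real ((cmod (f x))\<^sup>2) :: complex)"
    unfolding sqnorm_def
    by (rule mean_bounded_linear[OF bounded_linear_of_real, symmetric])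
      (rule continuous_on_cmod_square[OF assms])
  then show ?thesis
    by (simp add: conv_def star_def complex_norm_square mult.commute flip: of_real_power)
qed

lemma sqnorm_nonneg:
  fixes f :: "'a \<Rightarrow> complex"
  assumes "continuous_on UNIV f"
  shows "0 \<le> sqnorm f"
  unfolding sqnorm_def by (rule mean_ge[OF continuous_on_cmod_square[OF assms]]) simp

lemma sqnorm_pos:
  fixes f :: "'a \<Rightarrow> complex"
  assumes "continuous_on UNIV f" "f z \<noteq> 0"
  shows "0 < sqnorm f"
proof -
  define t where "t = (cmod (f z))\<^sup>2 / 2"
  have t: "0 < t" "t < (cmod (f z))\<^sup>2" using assms(2) by (auto simp: t_def)
  obtain c where c: "c > 0" "\<And>n. c * t ^ n \<le> mean (\<lambda>x. ((cmod (f x))\<^sup>2) ^ n)"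
    using mean_power_ge[OF continuous_on_cmod_square[OF assms(1)], of t z] t by auto
  have "0 < c * t" using c(1) t(1) by simp
  also have "c * t \<le> sqnorm f" using c(2)[of 1] by (simp add: sqnorm_def)
  finally show ?thesis .
qed

lemma sqnorm_le:
  fixes f :: "'a \<Rightarrow> complex"
  assumes "continuous_on UNIV f" "\<And>x. cmod (f x) \<le> B"
  shows "sqnorm f \<le> B\<^sup>2"
proof -
  have "norm (sqnorm f - 0) \<le> B\<^sup>2"
    unfolding sqnorm_def
    by (rule mean_norm_le[OF continuous_on_cmod_square[OF assms(1)]]) (simp add: assms(2) power_mono)
  then show ?thesis by simp
qed

text \<open>
  The Cauchy-Schwarz inequality, from the nonnegativity of the squared norm of
  \<open>\<parallel>v\<parallel>\<^sup>2 u - c v\<^sup>*\<close>, where \<open>c\<close> is the mean of \<open>u v\<close> and \<open>v\<^sup>*\<close> is the complex conjugate of \<open>v\<close>.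
\<close>

lemma mean_mult_square_le:
  fixes u v :: "'a \<Rightarrow> complex"
  assumes u: "continuous_on UNIV u" and v: "continuous_on UNIV v"
  shows "(cmod (mean (\<lambda>x. u x * v x)))\<^sup>2 \<le> sqnorm u * sqnorm v"
proof (cases "\<exists>z. v z \<noteq> 0")
  case False
  then show ?thesis
    using sqnorm_nonneg[OF u] sqnorm_nonneg[OF v]
    by (simp add: mean_eqI[OF has_mean_const])
next
  case True
  then have B: "0 < sqnorm v" using sqnorm_pos[OF v] by blast
  define c where "c = mean (\<lambda>x. u x * v x)"
  define w where "w x = of_real (sqnorm v) * u x - c * cnj (v x)" for x
  have uv: "continuous_on UNIV (\<lambda>x. u x * v x)" by (intro continuous_intros u v)
  have w: "continuous_on UNIV w" unfolding w_def by (intro continuous_intros u v)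
  have w2: "(cmod (w x))\<^sup>2 = ((sqnorm v)\<^sup>2 * (cmod (u x))\<^sup>2 + (cmod c)\<^sup>2 * (cmod (v x))\<^sup>2)
      - Re (2 * of_real (sqnorm v) * cnj c * (u x * v x))" for x
    unfolding w_def cmod_power2 by (simp add: power2_eq_square algebra_simps)
  have "sqnorm w = ((sqnorm v)\<^sup>2 * sqnorm u + (cmod c)\<^sup>2 * sqnorm v)
      - Re (2 * of_real (sqnorm v) * cnj c * c)"
  proof -
    note bl = mean_bounded_linear[OF bounded_linear_mult_right continuous_on_cmod_square]
    have "mean (\<lambda>x. Re (2 * of_real (sqnorm v) * cnj c * (u x * v x)))
        = Re (2 * of_real (sqnorm v) * cnj c * c)"
      unfolding c_def
      by (rule mean_bounded_linear[OF bounded_linear_compose[OF bounded_linear_Re bounded_linear_mult_right] uv])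
    moreover have "continuous_on UNIV (\<lambda>x. Re (2 * of_real (sqnorm v) * cnj c * (u x * v x)))"
      by (intro continuous_intros u v)
    moreover have "mean (\<lambda>x. (sqnorm v)\<^sup>2 * (cmod (u x))\<^sup>2 + (cmod c)\<^sup>2 * (cmod (v x))\<^sup>2)
        = (sqnorm v)\<^sup>2 * sqnorm u + (cmod c)\<^sup>2 * sqnorm v"
      unfolding sqnorm_def[of u] using bl[OF u, of "(sqnorm v)\<^sup>2"] bl[OF v, of "(cmod c)\<^sup>2"]
      by (subst mean_add) (auto simp: sqnorm_def intro!: continuous_intros u v)
    moreover have "continuous_on UNIV (\<lambda>x. (sqnorm v)\<^sup>2 * (cmod (u x))\<^sup>2 + (cmod c)\<^sup>2 * (cmod (v x))\<^sup>2)"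
      by (intro continuous_intros u v)
    ultimately show ?thesis unfolding sqnorm_def[of w] w2 by (simp only: mean_diff)
  qed
  also have "Re (2 * of_real (sqnorm v) * cnj c * c) = 2 * sqnorm v * (cmod c)\<^sup>2"
    by (simp add: cmod_power2) (simp add: power2_eq_square algebra_simps)
  finally have "0 \<le> sqnorm v * (sqnorm v * sqnorm u - (cmod c)\<^sup>2)"
    using sqnorm_nonneg[OF w] by (simp add: power2_eq_square algebra_simps)
  then show ?thesis using B unfolding c_def
    by (simp add: zero_le_mult_iff mult.commute)
qed

lemma conv_square_le:
  fixes f g :: "'a \<Rightarrow> complex"
  assumes f: "continuous_on UNIV f" and g: "continuous_on UNIV g"
  shows "(cmod (conv f g x))\<^sup>2 \<le> sqnorm f * sqnorm g"
proof -
  have "sqnorm (\<lambda>y. f (x - y)) = sqnorm f"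
    unfolding sqnorm_def by (rule mean_reflect[OF continuous_on_cmod_square[OF f]])
  moreover have "continuous_on UNIV (\<lambda>y. f (x - y))"
    by (intro continuous_on_compose2[OF f] continuous_intros) auto
  ultimately show ?thesis
    using mean_mult_square_le[OF _ g, of "\<lambda>y. f (x - y)"] by (simp add: conv_def)
qed

lemma sqnorm_conv_le:
  fixes f g :: "'a \<Rightarrow> complex"
  assumes f: "continuous_on UNIV f" and g: "continuous_on UNIV g"
  shows "sqnorm (conv f g) \<le> sqnorm f * sqnorm g"
proof -
  have "cmod (conv f g x) \<le> sqrt (sqnorm f * sqnorm g)" for x
    by (rule real_le_rsqrt[OF conv_square_le[OF f g]])
  from sqnorm_le[OF continuous_on_conv[OF f g] this] show ?thesis
    using sqnorm_nonneg[OF f] sqnorm_nonneg[OF g] by simp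
qed

lemma conv_uniform_limit:
  fixes w e :: "'a \<Rightarrow> complex"
  assumes w: "continuous_on UNIV w" and g: "\<And>n. continuous_on UNIV (g n)"
    and e: "continuous_on UNIV e" and lim: "uniform_limit UNIV g e sequentially"
  shows "(\<lambda>n. conv w (g n) x) \<longlonglongrightarrow> conv w e x"
proof (rule tendstoI)
  fix \<epsilon> :: real assume "\<epsilon> > 0"
  obtain B where B: "B > 0" "\<And>x. norm (w x) \<le> B" using bounded_continuous[OF w] by blast
  have "\<epsilon> / (2 * B) > 0" using \<open>\<epsilon> > 0\<close> B by simp
  from uniform_limitD[OF lim this]
  show "\<forall>\<^sub>F n in sequentially. dist (conv w (g n) x) (conv w e x) < \<epsilon>"
  proof eventually_elim
    case (elim n)
    have "norm (conv w (\<lambda>x. g n x - e x) x - 0) \<le> B * (\<epsilon> / (2 * B))"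
      unfolding conv_def
    proof (rule mean_norm_le)
      show "continuous_on UNIV (\<lambda>y. w (x - y) * (g n y - e y))"
        by (intro continuous_conv_arg continuous_intros w g e)
      show "norm (w (x - y) * (g n y - e y) - 0) \<le> B * (\<epsilon> / (2 * B))" for y
        unfolding diff_zero norm_mult
        by (rule mult_mono) (use B elim in \<open>auto simp: dist_norm less_imp_le\<close>)
    qed
    then show ?case using \<open>\<epsilon> > 0\<close> B(1) by (simp add: conv_diff_right w g e dist_norm)
  qed
qed

end

section \<open>Minimal projections\<close>

text \<open>
  For \<open>b n = \<parallel>h\<^sup>n\<^sup>+\<^sup>1\<parallel>\<^sup>2\<close> the limit \<open>\<rho>\<close> of the increasing ratios is the square of the spectral
  radius of \<open>h\<close>. Normalized by \<open>\<rho>\<close> the sequence decreases; submultiplicativity bounds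
  it from below, because \<open>b (m + n + 1) / b m \<le> b n\<close> and the left side tends to
  \<open>\<rho> ^ (n + 1)\<close> as \<open>m\<close> grows.
\<close>

lemma ratio_limit:
  fixes b :: "nat \<Rightarrow> real"
  assumes pos: "\<And>n. 0 < b n"
    and submult: "\<And>m n. b (m + n + 1) \<le> b m * b n"
    and logconvex: "\<And>n. (b (n + 1))\<^sup>2 \<le> b n * b (n + 2)"
  obtains \<rho> D where "\<rho> > 0" "D \<ge> 1" "(\<lambda>n. b n / \<rho> ^ (n + 1)) \<longlonglongrightarrow> D"
proof -
  define r where "r n = b (n + 1) / b n" for n
  have r_pos: "r n > 0" for n unfolding r_def using pos by simp
  have r_inc: "r n \<le> r (Suc n)" for n
    using logconvex[of n] pos[of n] pos[of "Suc n"]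
    by (simp add: r_def field_simps power2_eq_square)
  have r_le: "r n \<le> b 0" for n
    using submult[of 0 n] pos[of n] by (simp add: r_def field_simps)
  have "incseq r" by (rule incseq_SucI[of r, OF r_inc])
  then obtain \<rho> where \<rho>: "r \<longlonglongrightarrow> \<rho>" "\<And>n. r n \<le> \<rho>"
    using incseq_convergent[of r "b 0"] r_le by blast
  have \<rho>_pos: "\<rho> > 0" using r_pos[of 0] \<rho>(2)[of 0] by simp
  have quotient: "(\<lambda>m. b (m + k) / b m) \<longlonglongrightarrow> \<rho> ^ k" for k
  proof (induction k)
    case 0
    then show ?case using pos by (simp add: less_imp_neq[symmetric])
  next
    case (Suc k)
    have "(\<lambda>m. r (m + k)) \<longlonglongrightarrow> \<rho>" using \<rho>(1) by (rule LIMSEQ_ignore_initial_segment)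
    from tendsto_mult[OF this Suc] show ?case
      using pos by (simp add: r_def less_imp_neq[symmetric] add.assoc)
  qed
  have ge: "\<rho> ^ (n + 1) \<le> b n" for n
  proof (rule LIMSEQ_le_const2[OF quotient])
    show "\<exists>N. \<forall>m\<ge>N. b (m + (n + 1)) / b m \<le> b n"
      using submult[of _ n] pos by (simp add: field_simps)
  qed
  define d where "d n = b n / \<rho> ^ (n + 1)" for n
  have d_ge: "1 \<le> d n" for n using ge[of n] \<rho>_pos by (simp add: d_def)
  have "d (Suc n) \<le> d n" for n
  proof -
    have "b (Suc n) \<le> \<rho> * b n" using \<rho>(2)[of n] pos[of n] by (simp add: r_def field_simps)
    then show ?thesis using \<rho>_pos by (simp add: d_def field_simps)
  qed
  then have "decseq d" by (rule decseq_SucI)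
  then obtain D where D: "d \<longlonglongrightarrow> D"
    using decseq_convergent[of d 1] d_ge by blast
  then have "D \<ge> 1" using d_ge by (auto intro!: LIMSEQ_le_const[OF D])
  then show ?thesis using that \<rho>_pos D unfolding d_def by blast
qed

context compact_ab_group
begin

text \<open>
  Power iteration. On the spectral side \<open>h\<close> is a square summable family of real numbers indexed by
  the characters, so the even convolution powers of \<open>h\<close>, divided by the powers of the largest square
  \<open>\<rho>\<close>, converge to the sum of the characters where \<open>\<rho>\<close> is attained. The proof sees only the norms of the
  powers: by \<open>ratio_limit\<close> they converge after normalization, so the powers
  form a Cauchy sequence in norm, and one more convolution makes it uniformly Cauchy.
\<close>

lemma projection_of_hermitian:
  fixes h :: "'a \<Rightarrow> complex"
  assumes h: "continuous_on UNIV h" and herm: "star h = h" and "h z \<noteq> 0"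
  obtains e \<rho> where "is_projection e" "e 0 \<noteq> 0" "(\<rho>::real) > 0"
    "conv (conv h h) e = (\<lambda>x. of_real \<rho> * e x)"
    "\<And>w. continuous_on UNIV w \<Longrightarrow> conv w h = h \<Longrightarrow> conv w e = e"
proof -
  \<comment> \<open>\<open>H n\<close> is the convolution power of \<open>h\<close> with exponent \<open>n + 1\<close>.\<close>
  define H where "H n = (conv h ^^ n) h" for n
  have H0: "H 0 = h" and HS: "H (Suc n) = conv h (H n)" for n by (simp_all add: H_def)
  have Hc: "continuous_on UNIV (H n)" for n
    by (induction n) (simp_all add: H0 HS h continuous_on_conv)
  have Hconv: "conv (H m) (H n) = H (m + n + 1)" for m n
    by (induction m) (simp_all add: H0 HS h Hc conv_assoc)
  have Hstar: "star (H n) = H n" for n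
    by (induction n) (simp_all add: H0 HS h Hc star_conv herm)
  define b where "b n = sqnorm (H n)" for n
  have Hb: "H (2 * n + 1) 0 = of_real (b n)" for n
    using sqnorm_eq_conv[OF Hc, of n] Hconv[of n n] by (simp add: b_def Hstar mult_2)
  have logconvex: "(b (n + 1))\<^sup>2 \<le> b n * b (n + 2)" for n
  proof -
    have eq: "n + (n + 2) + 1 = 2 * (n + 1) + 1" by simp
    have "(cmod (conv (H n) (H (n + 2)) 0))\<^sup>2 \<le> b n * b (n + 2)"
      unfolding b_def by (rule conv_square_le[OF Hc Hc])
    then show ?thesis unfolding Hconv eq Hb by simp
  qed
  have submult: "b (m + n + 1) \<le> b m * b n" for m n
    using sqnorm_conv_le[OF Hc Hc, of m n] by (simp add: b_def Hconv)
  have pos: "0 < b n" for n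
  proof -
    have "0 < b 0" unfolding b_def H0 using h \<open>h z \<noteq> 0\<close> by (rule sqnorm_pos)
    have "0 < b n \<and> 0 < b (n + 1)"
    proof (induction n)
      case 0
      have "H 1 0 \<noteq> 0" using Hb[of 0] \<open>0 < b 0\<close> by simp
      then have "0 < b 1" unfolding b_def using sqnorm_pos[OF Hc] by blast
      with \<open>0 < b 0\<close> show ?case by simp
    next
      case (Suc n)
      then have "0 < (b (n + 1))\<^sup>2" by simp
      also note logconvex[of n]
      finally show ?case using Suc by (simp add: zero_less_mult_iff)
    qed
    then show ?thesis ..
  qed
  obtain \<rho> D where \<rho>: "\<rho> > 0" and D: "D \<ge> 1" "(\<lambda>n. b n / \<rho> ^ (n + 1)) \<longlonglongrightarrow> D"
    using ratio_limit[of b, OF pos submult logconvex] by blast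
  define d where "d n = b n / \<rho> ^ (n + 1)" for n
  \<comment> \<open>\<open>g n\<close> is the power of \<open>conv h h\<close> with exponent \<open>n + 1\<close>, divided by the same power of \<open>\<rho>\<close>.\<close>
  define g where "g n = (\<lambda>x. of_real (1 / \<rho> ^ (n + 1)) * H (2 * n + 1) x)" for n
  have gc: "continuous_on UNIV (g n)" for n
    unfolding g_def by (intro continuous_intros Hc)
  have gstar: "star (g n) = g n" for n
    using Hstar[of "2 * n + 1"] unfolding g_def star_def fun_eq_iff
    by (metis complex_cnj_complex_of_real complex_cnj_mult)
  have gconv: "conv (g m) (g n) = g (m + n + 1)" for m n
  proof -
    have "conv (g m) (g n) = (\<lambda>x. of_real (1 / \<rho> ^ (m + 1)) * (of_real (1 / \<rho> ^ (n + 1))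
        * conv (H (2 * m + 1)) (H (2 * n + 1)) x))"
      unfolding g_def
      by (subst conv_scale_left, intro continuous_intros Hc, rule Hc, subst conv_scale_right[OF Hc Hc], rule refl)
    also have "\<dots> = g (m + n + 1)"
      unfolding Hconv g_def using \<rho> by (simp add: power_add algebra_simps fun_eq_iff)
    finally show ?thesis .
  qed
  have g0: "g n 0 = of_real (d n)" for n
    using Hb[of n] by (simp add: g_def d_def)
  have Fg: "conv (H 1) (g n) = (\<lambda>x. of_real \<rho> * g (Suc n) x)" for n
    unfolding g_def using \<rho>
    by (simp add: conv_scale_right[OF Hc Hc] Hconv del: of_real_divide) (simp add: field_simps)
  have sq_diff: "sqnorm (\<lambda>x. g n x - g m x) = d (2 * n + 1) - 2 * d (n + m + 1) + d (2 * m + 1)" for n m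
  proof -
    have "star (\<lambda>x. g n x - g m x) = (\<lambda>x. g n x - g m x)"
      using gstar[of n] gstar[of m] by (simp add: star_def fun_eq_iff)
    then have "of_real (sqnorm (\<lambda>x. g n x - g m x)) = conv (\<lambda>x. g n x - g m x) (\<lambda>x. g n x - g m x) 0"
      using sqnorm_eq_conv[of "\<lambda>x. g n x - g m x"] gc by (simp add: continuous_on_diff)
    also have "\<dots> = (g (n + n + 1) 0 - g (n + m + 1) 0) - (g (m + n + 1) 0 - g (m + m + 1) 0)"
      unfolding conv_diff_left[OF continuous_on_diff[OF gc gc] gc gc] conv_diff_right[OF gc gc gc]
        gconv ..
    also have "\<dots> = of_real (d (2 * n + 1) - 2 * d (n + m + 1) + d (2 * m + 1))"
    proof -
      have eqs: "n + n + 1 = 2 * n + 1" "m + m + 1 = 2 * m + 1" "m + n + 1 = n + m + 1" by simp_all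
      show ?thesis unfolding g0 eqs by simp
    qed
    finally show ?thesis by (simp only: of_real_eq_iff)
  qed
  have ucauchy: "uniformly_Cauchy_on UNIV g"
    unfolding uniformly_Cauchy_on_def
  proof (intro allI impI)
    fix \<epsilon> :: real assume "\<epsilon> > 0"
    define K where "K = sqnorm (H 1) / \<rho>\<^sup>2 + 1"
    have K: "K > 0" unfolding K_def using sqnorm_nonneg[OF Hc, of 1] \<rho> by (simp add: add_nonneg_pos)
    define \<delta> where "\<delta> = \<epsilon>\<^sup>2 / (2 * K)"
    have "\<delta> > 0" using K \<open>\<epsilon> > 0\<close> by (simp add: \<delta>_def)
    have "Cauchy d" using D(2) unfolding d_def by (rule LIMSEQ_imp_Cauchy)
    then obtain M where M: "\<And>m n. m \<ge> M \<Longrightarrow> n \<ge> M \<Longrightarrow> dist (d m) (d n) < \<delta>"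
      using \<open>\<delta> > 0\<close> unfolding Cauchy_def by blast
    have close: "dist (g (Suc m) x) (g (Suc n) x) < \<epsilon>" if "m \<ge> M" "n \<ge> M" for m n x
    proof -
      have "sqnorm (\<lambda>x. g m x - g n x) < 2 * \<delta>"
        using M[of "2 * m + 1" "m + n + 1"] M[of "2 * n + 1" "m + n + 1"] that
        by (simp add: sq_diff dist_real_def)
      have "conv (H 1) (\<lambda>x. g m x - g n x) x = of_real \<rho> * (g (Suc m) x - g (Suc n) x)"
        unfolding conv_diff_right[OF Hc gc gc] Fg by (simp add: right_diff_distrib)
      then have "\<rho>\<^sup>2 * (cmod (g (Suc m) x - g (Suc n) x))\<^sup>2 = (cmod (conv (H 1) (\<lambda>x. g m x - g n x) x))\<^sup>2"
        using \<rho> by (simp only: norm_mult power_mult_distrib norm_of_real power2_abs)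
      also have "\<dots> \<le> sqnorm (H 1) * sqnorm (\<lambda>x. g m x - g n x)"
        by (intro conv_square_le Hc continuous_intros gc)
      finally have "(cmod (g (Suc m) x - g (Suc n) x))\<^sup>2 \<le> sqnorm (H 1) / \<rho>\<^sup>2 * sqnorm (\<lambda>x. g m x - g n x)"
        using \<rho> by (simp add: field_simps)
      also have "\<dots> \<le> K * sqnorm (\<lambda>x. g m x - g n x)"
        by (intro mult_right_mono sqnorm_nonneg continuous_intros gc) (simp add: K_def)
      also have "\<dots> < K * (2 * \<delta>)"
        using K \<open>sqnorm (\<lambda>x. g m x - g n x) < 2 * \<delta>\<close> by simp
      also have "\<dots> = \<epsilon>\<^sup>2" using K by (simp add: \<delta>_def)
      finally show ?thesis using \<open>\<epsilon> > 0\<close>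
        by (simp add: dist_norm power2_less_imp_less)
    qed
    show "\<exists>M. \<forall>x\<in>UNIV. \<forall>m\<ge>M. \<forall>n\<ge>M. dist (g m x) (g n x) < \<epsilon>"
      by (rule exI[of _ "Suc M"]) (metis Suc_le_D Suc_le_mono close)
  qed
  then obtain e where e: "uniform_limit UNIV g e sequentially"
    using Cauchy_uniformly_convergent uniformly_convergent_on_def by blast
  have ec: "continuous_on UNIV e"
    by (rule uniform_limit_theorem[OF _ e]) (simp_all add: gc)
  have lim: "(\<lambda>n. g n x) \<longlonglongrightarrow> e x" for x
    by (rule tendsto_uniform_limitI[OF e]) simp
  have conv_lim: "(\<lambda>n. conv w (g n) x) \<longlonglongrightarrow> conv w e x" if "continuous_on UNIV w" for w x
    by (rule conv_uniform_limit[OF that gc ec e])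
  have absorb: "conv w e = e" if w: "continuous_on UNIV w" "\<And>n. conv w (g n) = g n" for w
    using LIMSEQ_unique[OF conv_lim[OF w(1)]] lim by (auto simp: w(2) fun_eq_iff)
  have "star e = e"
  proof
    fix x
    have "(\<lambda>n. star (g n) x) \<longlonglongrightarrow> star e x"
      unfolding star_def by (intro tendsto_cnj lim)
    then show "star e x = e x" using lim LIMSEQ_unique by (simp add: gstar) blast
  qed
  moreover have "conv e e = e"
  proof -
    have ge: "conv (g n) e = e" for n
    proof
      fix x
      have "(\<lambda>m. conv (g n) (g m) x) \<longlonglongrightarrow> e x"
        unfolding gconv using LIMSEQ_ignore_initial_segment[OF lim, of "n + 1" x]
        by (simp add: add_ac)
      then show "conv (g n) e x = e x" using conv_lim[OF gc] LIMSEQ_unique by blast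
    qed
    show ?thesis
    proof
      fix x
      have "(\<lambda>n. conv e (g n) x) \<longlonglongrightarrow> e x"
        using ge by (simp add: conv_commute[OF ec gc])
      then show "conv e e x = e x" using conv_lim[OF ec] LIMSEQ_unique by blast
    qed
  qed
  moreover have "e 0 \<noteq> 0"
  proof -
    have "(\<lambda>n. of_real (d n)) \<longlonglongrightarrow> e 0" using lim[of 0] by (simp add: g0)
    moreover have "(\<lambda>n. of_real (d n)) \<longlonglongrightarrow> (of_real D :: complex)"
      using D(2) unfolding d_def by (rule tendsto_of_real)
    ultimately have "e 0 = of_real D" using LIMSEQ_unique by blast
    then show ?thesis using D(1) by auto
  qed
  moreover have "conv (conv h h) e = (\<lambda>x. of_real \<rho> * e x)"
  proof
    fix x
    have "(\<lambda>n. of_real \<rho> * g (Suc n) x) \<longlonglongrightarrow> of_real \<rho> * e x"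
      by (intro tendsto_mult tendsto_const LIMSEQ_Suc lim)
    then have "(\<lambda>n. conv (H 1) (g n) x) \<longlonglongrightarrow> of_real \<rho> * e x" by (simp only: Fg)
    moreover have "H 1 = conv h h" by (simp add: H_def)
    ultimately show "conv (conv h h) e x = of_real \<rho> * e x"
      using conv_lim[OF Hc[of 1], of x] LIMSEQ_unique by metis
  qed
  moreover have "conv w e = e" if w: "continuous_on UNIV w" "conv w h = h" for w
  proof (rule absorb[OF w(1)])
    fix n
    have "conv w (H n) = H n" for n
      by (induction n) (simp_all add: H0 HS w h Hc flip: conv_assoc)
    then show "conv w (g n) = g n"
      unfolding g_def conv_scale_right[OF w(1) Hc] by (simp only:)
  qed
  ultimately show ?thesis using that[of e \<rho>] ec \<rho> by (simp add: is_projection_def)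
qed


definition is_minimal_projection :: "('a \<Rightarrow> complex) \<Rightarrow> bool" where
  "is_minimal_projection e \<longleftrightarrow> is_projection e \<and> e \<noteq> (\<lambda>x. 0) \<and>
    (\<forall>e'. is_projection e' \<and> e' \<noteq> (\<lambda>x. 0) \<and> conv e e' = e' \<longrightarrow> e' = e)"

lemma projection_at_0:
  fixes e :: "'a \<Rightarrow> complex"
  assumes "is_projection e"
  shows "e 0 = of_real (sqnorm e)"
  using sqnorm_eq_conv[of e] assms by (simp add: is_projection_def)

text \<open>
  Convolution with \<open>e\<close> reproduces \<open>e\<close>, so \<open>\<bar>e\<bar>\<close> is bounded by \<open>\<parallel>e\<parallel>\<^sup>2\<close>, and hence
  \<open>\<parallel>e\<parallel>\<^sup>2 \<le> \<parallel>e\<parallel>\<^sup>4\<close>. In fact \<open>\<parallel>e\<parallel>\<^sup>2\<close> is the rank of the projection.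
\<close>

lemma sqnorm_projection_ge_1:
  fixes e :: "'a \<Rightarrow> complex"
  assumes e: "is_projection e" and "e \<noteq> (\<lambda>x. 0)"
  shows "1 \<le> sqnorm e"
proof -
  obtain z where "e z \<noteq> 0" using assms(2) by blast
  have c: "continuous_on UNIV e" and ee: "conv e e = e"
    using e by (simp_all add: is_projection_def)
  have "cmod (e x) \<le> sqnorm e" for x
    using conv_square_le[OF c c, of x] sqnorm_nonneg[OF c]
    by (simp add: ee power2_eq_square[of "sqnorm e", symmetric])
  then have "sqnorm e \<le> (sqnorm e)\<^sup>2" by (rule sqnorm_le[OF c])
  with sqnorm_pos[OF c \<open>e z \<noteq> 0\<close>] show ?thesis by (simp add: power2_eq_square)
qed

text \<open>
  A projection whose squared norm exceeds the infimum by less than \<open>1\<close> is minimal: splitting off a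
  proper subprojection would lower the squared norm by at least \<open>1\<close>.
\<close>

lemma minimal_projection_below:
  fixes e\<^sub>0 :: "'a \<Rightarrow> complex"
  assumes e0: "is_projection e\<^sub>0" "e\<^sub>0 \<noteq> (\<lambda>x. 0)"
  obtains e where "is_minimal_projection e" "conv e\<^sub>0 e = e"
proof -
  define S where "S = {e. is_projection e \<and> e \<noteq> (\<lambda>x. 0) \<and> conv e\<^sub>0 e = e}"
  have "e\<^sub>0 \<in> S" using e0 unfolding S_def is_projection_def by blast
  have bdd: "bdd_below (sqnorm ` S)"
    by (rule bdd_belowI2[of _ 1]) (auto simp: S_def intro: sqnorm_projection_ge_1)
  define m where "m = Inf (sqnorm ` S)"
  have m_le: "m \<le> sqnorm e" if "e \<in> S" for e
    unfolding m_def using that bdd by (intro cInf_lower) auto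
  have "\<exists>v\<in>sqnorm ` S. v < m + 1"
    unfolding m_def using \<open>e\<^sub>0 \<in> S\<close> by (intro cInf_lessD) auto
  then obtain e where e: "e \<in> S" "sqnorm e < m + 1" by blast
  then have w: "is_projection e" "e \<noteq> (\<lambda>x. 0)" "conv e\<^sub>0 e = e" by (simp_all add: S_def)
  have "e' = e" if e': "is_projection e'" "e' \<noteq> (\<lambda>x. 0)" "conv e e' = e'" for e'
  proof (rule ccontr)
    assume "e' \<noteq> e"
    define d where "d = (\<lambda>x. e x - e' x)"
    have c: "continuous_on UNIV e" "continuous_on UNIV e'" "continuous_on UNIV e\<^sub>0"
      using w e' e0 by (simp_all add: is_projection_def)
    have "conv e' e = e'" using e'(3) conv_commute[OF c(1,2)] by simp
    then have "conv d d = d"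
      using w(1) e'(1,3) c unfolding d_def
      by (simp add: conv_diff_left conv_diff_right continuous_on_diff is_projection_def)
    moreover have "star d = d"
      using w(1) e'(1) by (simp add: d_def star_def is_projection_def fun_eq_iff)
    ultimately have d: "is_projection d"
      using c by (simp add: is_projection_def d_def continuous_on_diff)
    obtain x where "e x \<noteq> e' x" using \<open>e' \<noteq> e\<close> by (metis ext)
    then have "d x \<noteq> 0" by (simp add: d_def)
    then have "d \<noteq> (\<lambda>x. 0)" by auto
    have "of_real (sqnorm e) = (of_real (sqnorm e' + sqnorm d) :: complex)"
      unfolding of_real_add projection_at_0[OF d, symmetric] projection_at_0[OF w(1), symmetric]
        projection_at_0[OF e'(1), symmetric]
      by (simp add: d_def)
    then have "sqnorm e = sqnorm e' + sqnorm d" by (simp only: of_real_eq_iff)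
    moreover have "1 \<le> sqnorm d" using sqnorm_projection_ge_1[OF d \<open>d \<noteq> (\<lambda>x. 0)\<close>] .
    moreover have "e' \<in> S"
      using e' w(3) conv_assoc[OF c(3,1,2)] unfolding S_def by auto
    ultimately show False using m_le[of e'] e(2) by simp
  qed
  then have "is_minimal_projection e" unfolding is_minimal_projection_def using w by blast
  then show ?thesis using that w(3) by blast
qed

text \<open>
  The projection that power iteration extracts from a nonzero \<open>h\<close> lies below \<open>e\<close>, so it is \<open>e\<close>, and
  \<open>h * h = \<rho> e\<close>. Thus \<open>(h - \<surd>\<rho> e) * (h + \<surd>\<rho> e) = 0\<close>, and the same fact applied to
  the second factor shows that one of the two factors vanishes.
\<close>

lemma hermitian_below_minimal_projection:
  fixes e h :: "'a \<Rightarrow> complex"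
  assumes min: "is_minimal_projection e" and h: "continuous_on UNIV h" "star h = h" "conv e h = h"
  shows "\<exists>t::real. \<forall>x. h x = of_real t * e x"
proof (cases "\<exists>z. h z \<noteq> 0")
  case False
  then show ?thesis by (intro exI[of _ 0]) auto
next
  case True
  have e: "is_projection e" using min by (simp add: is_minimal_projection_def)
  have c: "continuous_on UNIV e" using e by (simp add: is_projection_def)
  have square: "\<exists>\<rho>>0. conv k k = (\<lambda>x. of_real \<rho> * e x)"
    if k: "continuous_on UNIV k" "star k = k" "conv e k = k" "k z \<noteq> 0" for k z
  proof -
    obtain e' \<rho> where e': "is_projection e'" "e' 0 \<noteq> 0" "\<rho> > 0"
      "conv (conv k k) e' = (\<lambda>x. of_real \<rho> * e' x)"
      "\<And>w. continuous_on UNIV w \<Longrightarrow> conv w k = k \<Longrightarrow> conv w e' = e'"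
      using projection_of_hermitian[OF k(1,2,4)] by blast
    have "e' \<noteq> (\<lambda>x. 0)" using e'(2) by auto
    then have "e' = e"
      using min e'(1) e'(5)[OF c k(3)] unfolding is_minimal_projection_def by blast
    have "conv k k = conv (conv e k) k" by (simp add: k(3))
    also have "\<dots> = conv (conv k k) e"
      using conv_assoc[OF c k(1) k(1)] conv_commute[OF c continuous_on_conv[OF k(1) k(1)]] by simp
    finally show ?thesis using e'(3,4) \<open>e' = e\<close> by auto
  qed
  obtain \<rho> where \<rho>: "\<rho> > 0" "conv h h = (\<lambda>x. of_real \<rho> * e x)"
    using square[OF h] True by blast
  define s where "s = complex_of_real (sqrt \<rho>)"
  have s: "s * s = of_real \<rho>" using \<rho>(1) by (simp add: s_def flip: of_real_mult)
  define k where "k = (\<lambda>x. h x + s * e x)"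
  define l where "l = (\<lambda>x. h x - s * e x)"
  have se: "continuous_on UNIV (\<lambda>x. s * e x)" by (intro continuous_intros c)
  have he: "conv h e = h" using h(3) conv_commute[OF c h(1)] by simp
  have ee: "conv e e = e" using e by (simp add: is_projection_def)
  have kc: "continuous_on UNIV k" and lc: "continuous_on UNIV l"
    unfolding k_def l_def by (intro continuous_intros h c)+
  have "star k = k"
    using h(2) e by (auto simp: k_def star_def is_projection_def fun_eq_iff s_def)
  have "conv e k = k" unfolding k_def by (simp add: conv_add_right conv_scale_right c h se ee)
  have "conv l e = l"
    unfolding l_def by (simp add: conv_diff_left conv_scale_left c h se ee he)
  have lk: "conv l k = (\<lambda>x. 0)"
    unfolding l_def k_def
    by (simp add: conv_diff_left conv_add_right conv_scale_left conv_scale_right c h(1,3) se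
        continuous_on_add ee he \<rho>(2) s mult.assoc[symmetric] fun_eq_iff)
  show ?thesis
  proof (cases "\<exists>z. k z \<noteq> 0")
    case False
    then have "h x = of_real (- sqrt \<rho>) * e x" for x
      by (simp add: k_def s_def eq_neg_iff_add_eq_0)
    then show ?thesis by blast
  next
    case True
    then obtain \<sigma> where \<sigma>: "\<sigma> > 0" "conv k k = (\<lambda>x. of_real \<sigma> * e x)"
      using square[OF kc \<open>star k = k\<close> \<open>conv e k = k\<close>] by blast
    have "(\<lambda>x. of_real \<sigma> * l x) = conv l (conv k k)"
      by (simp add: \<sigma>(2) conv_scale_right lc c \<open>conv l e = l\<close>)
    also have "\<dots> = (\<lambda>x. 0)"
      using conv_assoc[OF lc kc kc] conv_zero_right[of k] conv_commute[OF kc, of "\<lambda>x. 0"]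
      by (simp add: lk)
    finally have "l x = 0" for x using \<sigma>(1) by (simp add: fun_eq_iff)
    then have "h x = of_real (sqrt \<rho>) * e x" for x by (simp add: l_def s_def)
    then show ?thesis by blast
  qed
qed

section \<open>Characters separate points\<close>

text \<open>
  The symmetric and the antisymmetric combination of the translates of \<open>e\<close> by \<open>a\<close> and \<open>- a\<close> are
  hermitian (the latter after multiplication by \<open>\<i>\<close>), hence real multiples of \<open>e\<close>; so each
  translate is a complex multiple of \<open>e\<close>, which says that \<open>e\<close> is multiplicative up to normalization.
\<close>

lemma character_of_minimal_projection:
  fixes e :: "'a \<Rightarrow> complex"
  assumes min: "is_minimal_projection e"
  shows "e 0 \<noteq> 0" "is_character (\<lambda>x. e x / e 0)"
proof -
  have e: "is_projection e" "e \<noteq> (\<lambda>x. 0)" using min by (simp_all add: is_minimal_projection_def)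
  have c: "continuous_on UNIV e" and ee: "conv e e = e" and se: "\<And>x. cnj (e (- x)) = e x"
    using e(1) by (auto simp: is_projection_def star_def fun_eq_iff)
  show e0: "e 0 \<noteq> 0"
    using sqnorm_projection_ge_1[OF e] projection_at_0[OF e(1)] by auto
  have shift_eigen: "\<exists>\<zeta>. \<forall>x. e (x + a) = \<zeta> * e x" for a
  proof -
    have sc: "continuous_on UNIV (\<lambda>x. e (x + a))" "continuous_on UNIV (\<lambda>x. e (x + - a))"
      by (intro continuous_on_shift c)+
    define h1 where "h1 = (\<lambda>x. e (x + a) + e (x + - a))"
    define h2 where "h2 = (\<lambda>x. \<i> * (e (x + a) - e (x + - a)))"
    have star_e: "cnj (e (- x + a)) = e (x + - a)" "cnj (e (- x + - a)) = e (x + a)" for x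
      using se[of "x + - a"] se[of "x + a"] by (simp_all add: algebra_simps)
    have hc: "continuous_on UNIV h1" "continuous_on UNIV h2"
      unfolding h1_def h2_def by (intro continuous_intros sc)+
    have "star h1 = h1" "star h2 = h2"
      using star_e by (simp_all add: h1_def h2_def star_def fun_eq_iff algebra_simps)
    moreover have "conv e h1 = h1"
      unfolding h1_def conv_add_right[OF c sc] conv_shift_right[OF c c] ee ..
    moreover have "conv e h2 = h2"
      unfolding h2_def conv_scale_right[OF c continuous_on_diff[OF sc]] conv_diff_right[OF c sc]
        conv_shift_right[OF c c] ee ..
    ultimately obtain t1 t2 where "\<And>x. h1 x = of_real t1 * e x" "\<And>x. h2 x = of_real t2 * e x"
      using hermitian_below_minimal_projection[OF min hc(1)]
        hermitian_below_minimal_projection[OF min hc(2)] by blast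
    then have t: "e (x + a) + e (x - a) = of_real t1 * e x" "\<i> * (e (x + a) - e (x - a)) = of_real t2 * e x" for x
      by (simp_all add: h1_def h2_def)
    have "e (x + a) = ((of_real t1 - \<i> * of_real t2) / 2) * e x" for x
    proof -
      have "2 * e (x + a) = (e (x + a) + e (x - a)) - \<i> * (\<i> * (e (x + a) - e (x - a)))"
        by simp
      also have "\<dots> = (of_real t1 - \<i> * of_real t2) * e x"
        unfolding t by (simp add: algebra_simps)
      finally show ?thesis by (simp add: mult.commute)
    qed
    then show ?thesis by blast
  qed
  have mult: "e (x + a) / e 0 = (e x / e 0) * (e a / e 0)" for x a
  proof -
    obtain \<zeta> where \<zeta>: "\<And>x. e (x + a) = \<zeta> * e x" using shift_eigen by blast
    show ?thesis using \<zeta>[of x] \<zeta>[of 0] e0 by simp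
  qed
  moreover have "cmod (e x / e 0) = 1" for x
  proof -
    have "cnj (e 0) = e 0" using se[of 0] by simp
    have "cmod (e (- x)) = cmod (e x)" by (metis se complex_mod_cnj)
    then have "cmod (e x / e 0) * cmod (e x / e 0) = cmod (e (x + - x) / e 0)"
      unfolding mult by (simp only: norm_mult norm_divide)
    then have "(cmod (e x / e 0))\<^sup>2 = 1" using e0 by (simp add: power2_eq_square)
    then show ?thesis using norm_ge_zero[of "e x / e 0"] by (simp add: power2_eq_1_iff)
  qed
  moreover have "continuous_on UNIV (\<lambda>x. e x / e 0)"
    using e0 by (intro continuous_intros c) auto
  ultimately show "is_character (\<lambda>x. e x / e 0)" unfolding is_character_def by blast
qed

lemma continuous_separation:
  fixes x y :: 'a
  assumes "x \<noteq> y"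
  obtains k :: "'a \<Rightarrow> real" where "continuous_on UNIV k" "k x = 0" "k y = 1"
proof -
  have "Hausdorff_space (euclidean :: 'a topology)"
    unfolding Hausdorff_space_def disjnt_def using hausdorff by fastforce
  then have "normal_space (euclidean :: 'a topology)"
    by (intro compact_Hausdorff_or_regular_imp_normal_space)
      (auto simp: compact_space_def compact_UNIV)
  moreover have "closedin euclidean {x}" "closedin euclidean {y}" "disjnt {x} {y}"
    using assms by (auto simp: disjnt_def)
  ultimately obtain k where "continuous_map euclidean (top_of_set {0..1::real}) k"
      "k ` {x} \<subseteq> {0}" "k ` {y} \<subseteq> {1}"
    using Urysohn_lemma[of euclidean "{x}" "{y}" 0 1] by auto
  then show ?thesis by (intro that[of k]) (auto simp: continuous_map_in_subtopology)
qed

text \<open>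
  Convolution with \<open>u = k - k(\<sqdot> + a)\<close> annihilates every function of period \<open>a\<close>. A
  minimal projection in the ideal generated by \<open>u\<close> is not annihilated, so its character does not have
  period \<open>a\<close>.
\<close>

theorem characters_separate_points:
  fixes a :: 'a
  assumes "a \<noteq> 0"
  obtains \<phi> where "is_character \<phi>" "\<phi> a \<noteq> 1"
proof -
  obtain k :: "'a \<Rightarrow> real" where k: "continuous_on UNIV k" "k a = 0" "k 0 = 1"
    using continuous_separation[OF assms] by blast
  define k' where "k' x = complex_of_real (k x)" for x
  define u where "u = (\<lambda>x. k' x - k' (x + a))"
  have kc: "continuous_on UNIV k'" unfolding k'_def by (intro continuous_intros k)
  have uc: "continuous_on UNIV u" unfolding u_def by (intro continuous_intros kc continuous_on_shift)
  have "u 0 \<noteq> 0" using k by (simp add: u_def k'_def)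
  define h where "h = conv (star u) u"
  have suc: "continuous_on UNIV (star u)" by (rule continuous_on_star[OF uc])
  have hc: "continuous_on UNIV h" unfolding h_def by (rule continuous_on_conv[OF suc uc])
  have "star h = h" unfolding h_def by (simp add: star_conv suc uc conv_commute)
  have "h 0 = of_real (sqnorm u)" by (simp add: h_def sqnorm_eq_conv[OF uc])
  then have "h 0 \<noteq> 0" using sqnorm_pos[OF uc \<open>u 0 \<noteq> 0\<close>] by simp
  obtain e\<^sub>0 \<rho> where e0: "is_projection e\<^sub>0" "e\<^sub>0 0 \<noteq> 0" "\<rho> > 0"
      "conv (conv h h) e\<^sub>0 = (\<lambda>x. complex_of_real \<rho> * e\<^sub>0 x)"
    using projection_of_hermitian[OF hc \<open>star h = h\<close> \<open>h 0 \<noteq> 0\<close>] by blast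
  have "e\<^sub>0 \<noteq> (\<lambda>x. 0)" using e0(2) by auto
  then obtain e where min: "is_minimal_projection e" and e0e: "conv e\<^sub>0 e = e"
    using minimal_projection_below[OF e0(1)] by blast
  have e: "is_projection e" "e \<noteq> (\<lambda>x. 0)" "conv e\<^sub>0 e = e"
    using min e0e by (simp_all add: is_minimal_projection_def)
  note char = character_of_minimal_projection[OF min]
  have c0: "continuous_on UNIV e\<^sub>0" and c: "continuous_on UNIV e"
    using e0 e by (simp_all add: is_projection_def)
  have hhc: "continuous_on UNIV (conv h h)" by (rule continuous_on_conv[OF hc hc])
  have "e a / e 0 \<noteq> 1"
  proof
    assume "e a / e 0 = 1"
    then have shift: "e (x + a) = e x" for x
      using char unfolding is_character_def by (metis divide_cancel_right mult.right_neutral)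
    have "conv u e = (\<lambda>x. conv k' e x - conv e (\<lambda>x. k' (x + a)) x)"
      unfolding u_def
      by (simp add: conv_diff_left kc continuous_on_shift c conv_commute[OF c])
    also have "conv e (\<lambda>x. k' (x + a)) = conv (\<lambda>x. e (x + a)) k'"
      by (simp only: conv_shift_right[OF c kc] conv_shift_left)
    also have "\<dots> = conv k' e" by (simp add: shift conv_commute[OF c kc])
    finally have "conv u e = (\<lambda>x. 0)" by simp
    then have "conv h e = (\<lambda>x. 0)"
      unfolding h_def by (simp add: conv_assoc suc uc c conv_zero_right)
    then have "conv (conv h h) e = (\<lambda>x. 0)" by (simp add: conv_assoc hc c conv_zero_right)
    moreover have "conv (conv h h) e = conv (conv (conv h h) e\<^sub>0) e"
      by (simp add: conv_assoc[OF hhc c0 c] e(3))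
    ultimately have "(\<lambda>x. of_real \<rho> * e x) = (\<lambda>x. 0)"
      by (simp add: e0(4) conv_scale_left c c0 e(3))
    then show False using e(2) e0(3) by (auto simp: fun_eq_iff)
  qed
  then show ?thesis using that char(2) by blast
qed

end

section \<open>Independent families in abelian groups\<close>

text \<open>
  An abelian group as a module over the integers, so that generated subgroups are spans.
\<close>

locale int_module = module scale
  for scale :: "int \<Rightarrow> 'b::ab_group_add \<Rightarrow> 'b" (infixr \<open>\<odot>\<close> 75)
begin

text \<open>
  Torsion elements may belong to such a family, in contrast to linear independence over the integers:
  a relation between members forces every term of the relation to vanish, but not its coefficient.
\<close>

definition independent_family :: "'b set \<Rightarrow> bool" where
  "independent_family I \<longleftrightarrow> 0 \<notin> I \<and>
    (\<forall>A B. A \<subseteq> I \<longrightarrow> B \<subseteq> I \<longrightarrow> A \<inter> B = {} \<longrightarrow> span A \<inter> span B \<subseteq> {0})"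

lemma independent_familyD:
  assumes "independent_family I" "A \<subseteq> I" "B \<subseteq> I" "A \<inter> B = {}" "x \<in> span A" "x \<in> span B"
  shows "x = 0"
  using assms unfolding independent_family_def by blast

lemma span_finite_support:
  assumes "x \<in> span A"
  obtains F where "finite F" "F \<subseteq> A" "x \<in> span F"
proof -
  obtain F r where F: "finite F" "F \<subseteq> A" "x = (\<Sum>a\<in>F. r a \<odot> a)"
    using assms unfolding span_explicit by blast
  have "x \<in> span F" unfolding F(3) by (intro span_sum span_scale span_base)
  with F that show ?thesis by blast
qed

lemma countable_span:
  assumes "countable A"
  shows "countable (span A)"
proof -
  have fin: "countable (span F)" if "finite F" for F
    using that
  proof induction
    case (insert a F)
    have "span (insert a F) \<subseteq> (\<Union>k. (\<lambda>y. y + k \<odot> a) ` span F)"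
    proof
      fix x assume "x \<in> span (insert a F)"
      then obtain k where "x - k \<odot> a \<in> span F" by (auto simp: span_insert)
      then have "(x - k \<odot> a) + k \<odot> a \<in> (\<lambda>y. y + k \<odot> a) ` span F" by (rule imageI)
      then show "x \<in> (\<Union>k. (\<lambda>y. y + k \<odot> a) ` span F)" by auto
    qed
    moreover have "countable (\<Union>k. (\<lambda>y. y + k \<odot> a) ` span F)"
      using insert by (intro countable_UN countableI_type countable_image)
    ultimately show ?case by (rule countable_subset)
  qed simp
  have "span A \<subseteq> (\<Union>F\<in>{F. finite F \<and> F \<subseteq> A}. span F)"
    by (blast elim: span_finite_support)
  moreover have "countable (\<Union>F\<in>{F. finite F \<and> F \<subseteq> A}. span F)"
    using fin countable_Collect_finite_subset[OF assms] by (intro countable_UN) auto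
  ultimately show ?thesis by (rule countable_subset)
qed

text \<open>
  If no nonzero multiple of \<open>x\<close> were in the span of a maximal family, then \<open>x\<close> could be added to it.
\<close>

lemma maximal_independent_family:
  obtains I where "independent_family I"
    "\<And>x. x \<noteq> 0 \<Longrightarrow> \<exists>k. k \<odot> x \<noteq> 0 \<and> k \<odot> x \<in> span I"
proof -
  have "\<exists>I\<in>{I. independent_family I}. \<forall>J\<in>{I. independent_family I}. I \<subseteq> J \<longrightarrow> J = I"
  proof (rule subset_Zorn_nonempty)
    have "independent_family {}" by (auto simp: independent_family_def)
    then show "{I. independent_family I} \<noteq> {}" by blast
  next
    fix \<C> assume C: "\<C> \<noteq> {}" "subset.chain {I. independent_family I} \<C>"
    then have ind: "independent_family I" if "I \<in> \<C>" for I
      using that by (auto simp: subset_chain_def)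
    have "x = 0" if A: "A \<subseteq> \<Union>\<C>" "B \<subseteq> \<Union>\<C>" "A \<inter> B = {}" "x \<in> span A" "x \<in> span B" for A B x
    proof -
      obtain F where F: "finite F" "F \<subseteq> A" "x \<in> span F" using span_finite_support[OF A(4)] .
      obtain E where E: "finite E" "E \<subseteq> B" "x \<in> span E" using span_finite_support[OF A(5)] .
      have "finite (F \<union> E)" "F \<union> E \<subseteq> \<Union>\<C>" using E F A by auto
      from finite_subset_Union_chain[OF this C] obtain I where "I \<in> \<C>" "F \<union> E \<subseteq> I" .
      then show ?thesis using independent_familyD[OF ind, of I F E x] E F A(3) by blast
    qed
    then show "\<Union>\<C> \<in> {I. independent_family I}"
      using ind by (auto simp: independent_family_def)
  qed
  then obtain I where I: "independent_family I" "\<And>J. independent_family J \<Longrightarrow> I \<subseteq> J \<Longrightarrow> J = I"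
    by auto
  have "\<exists>k. k \<odot> x \<noteq> 0 \<and> k \<odot> x \<in> span I" if "x \<noteq> 0" for x
  proof (rule ccontr)
    assume "\<not> (\<exists>k. k \<odot> x \<noteq> 0 \<and> k \<odot> x \<in> span I)"
    then have trivial: "k \<odot> x = 0" if "k \<odot> x \<in> span I" for k using that by blast
    have "x \<notin> I"
    proof
      assume "x \<in> I"
      then have "1 \<odot> x \<in> span I" by (simp add: span_base)
      then show False using trivial[of 1] \<open>x \<noteq> 0\<close> by simp
    qed
    have one_side: "y = 0"
      if A: "A \<subseteq> insert x I" "B \<subseteq> I" "A \<inter> B = {}" "y \<in> span A" "y \<in> span B" for A B y
    proof -
      have sub: "A - {x} \<subseteq> I" using A(1) by blast
      have "y \<in> span (insert x (A - {x}))" using A(4) span_mono[of A "insert x (A - {x})"] by blast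
      then obtain k where k: "y - k \<odot> x \<in> span (A - {x})" unfolding span_insert by blast
      have "y \<in> span I" "y - k \<odot> x \<in> span I"
        using A(2,5) k span_mono[OF A(2)] span_mono[OF sub] by blast+
      then have "k \<odot> x \<in> span I" using span_diff[of y I "y - k \<odot> x"] by simp
      then have "k \<odot> x = 0" by (rule trivial)
      then have "y \<in> span (A - {x})" using k by simp
      then show ?thesis using independent_familyD[OF I(1) sub A(2)] A(3,5) by blast
    qed
    have "independent_family (insert x I)"
      unfolding independent_family_def
    proof (intro conjI allI impI subsetI)
      show "0 \<notin> insert x I" using I(1) \<open>x \<noteq> 0\<close> by (auto simp: independent_family_def)
    next
      fix A B y assume A: "A \<subseteq> insert x I" "B \<subseteq> insert x I" "A \<inter> B = {}" "y \<in> span A \<inter> span B"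
      then consider "B \<subseteq> I" | "A \<subseteq> I" by blast
      then show "y \<in> {0}"
      proof cases
        case 1
        then show ?thesis using one_side[of A B y] A by simp
      next
        case 2
        then show ?thesis using one_side[of B A y] A by (simp add: Int_commute)
      qed
    qed
    then show False using I(2) \<open>x \<notin> I\<close> by blast
  qed
  with I(1) that show ?thesis by blast
qed

lemma countable_fibre:
  assumes "countable {x. k \<odot> x = 0}"
  shows "countable {x. k \<odot> x = y}"
proof (cases "\<exists>z. k \<odot> z = y")
  case True
  then obtain z where z: "k \<odot> z = y" by blast
  have "{x. k \<odot> x = y} \<subseteq> (\<lambda>x. x + z) ` {x. k \<odot> x = 0}"
  proof
    fix x assume "x \<in> {x. k \<odot> x = y}"
    then have "x - z \<in> {x. k \<odot> x = 0}" using z by (simp add: scale_right_diff_distrib)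
    then have "(x - z) + z \<in> (\<lambda>x. x + z) ` {x. k \<odot> x = 0}" by (rule imageI)
    then show "x \<in> (\<lambda>x. x + z) ` {x. k \<odot> x = 0}" by simp
  qed
  then show ?thesis using assms by (meson countable_image countable_subset)
qed simp

text \<open>
  Elements of prime order lie in \<open>S\<close>, because a nonzero multiple does and the multiplier is invertible
  modulo the prime. By induction on \<open>n\<close> only countably many elements are killed by \<open>n\<close>: multiplication by
  \<open>n / p\<close> maps them into \<open>S\<close>, with countable fibres. Every nonzero element has a
  nonzero multiple in \<open>S\<close>, and there are countably many multipliers with countable fibres.
\<close>

lemma countable_essential_extension:
  assumes S: "countable S" "subspace S"
    and ess: "\<And>x. x \<noteq> 0 \<Longrightarrow> \<exists>k. k \<odot> x \<noteq> 0 \<and> k \<odot> x \<in> S"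
  shows "countable (UNIV :: 'b set)"
proof -
  have socle: "x \<in> S" if "prime p" "int p \<odot> x = 0" for p x
  proof (cases "x = 0")
    case False
    then obtain k where k: "k \<odot> x \<noteq> 0" "k \<odot> x \<in> S" using ess by blast
    have "\<not> int p dvd k"
    proof
      assume "int p dvd k"
      then obtain l where "k = l * int p" by (auto simp: dvd_def mult.commute)
      then have "k \<odot> x = l \<odot> (int p \<odot> x)" by simp
      then show False using k(1) that(2) by simp
    qed
    then have "coprime (int p) k" using that(1) by (simp add: prime_imp_coprime)
    then obtain u v where "u * int p + v * k = 1" using bezout_int[of "int p" k] by auto
    then have "x = (u * int p + v * k) \<odot> x" by simp
    also have "\<dots> = u \<odot> (int p \<odot> x) + v \<odot> (k \<odot> x)" by (simp add: scale_left_distrib)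
    also have "\<dots> \<in> S" using that(2) subspace_scale[OF S(2) k(2), of v] by simp
    finally show ?thesis .
  qed (use S(2) subspace_0 in simp)
  have torsion: "countable {x. int n \<odot> x = 0}" if "n > 0" for n
    using that
  proof (induction n rule: less_induct)
    case (less n)
    show ?case
    proof (cases "n = 1")
      case False
      then obtain p where p: "prime p" "p dvd n" using prime_factor_nat by blast
      then obtain m where m: "n = p * m" by (auto simp: dvd_def)
      then have "0 < m" "m < n" using less.prems prime_gt_1_nat[OF p(1)] by auto
      then have "countable {x. int m \<odot> x = y}" for y using less.IH countable_fibre by blast
      then have "countable (\<Union>y\<in>S. {x. int m \<odot> x = y})" using S(1) by (intro countable_UN)
      moreover have "{x. int n \<odot> x = 0} \<subseteq> (\<Union>y\<in>S. {x. int m \<odot> x = y})"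
        using socle[OF p(1)] by (auto simp: m)
      ultimately show ?thesis using countable_subset by blast
    qed simp
  qed
  have "countable {x. k \<odot> x = 0}" if "k \<noteq> 0" for k
  proof -
    have "k \<odot> x = 0 \<longleftrightarrow> int (nat \<bar>k\<bar>) \<odot> x = 0" for x by (cases "k \<ge> 0") auto
    then show ?thesis using torsion[of "nat \<bar>k\<bar>"] that by simp
  qed
  then have "countable {x. k \<odot> x = y}" if "k \<noteq> 0" for k y using that countable_fibre by blast
  then have "countable ({0} \<union> (\<Union>k\<in>- {0}. \<Union>y\<in>S. {x. k \<odot> x = y}))"
    using S(1) by (intro countable_Un countable_UN countableI_type) auto
  moreover have "UNIV \<subseteq> {0} \<union> (\<Union>k\<in>- {0}. \<Union>y\<in>S. {x. k \<odot> x = y})"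
  proof
    fix x :: 'b
    show "x \<in> {0} \<union> (\<Union>k\<in>- {0}. \<Union>y\<in>S. {x. k \<odot> x = y})"
    proof (cases "x = 0")
      case False
      then obtain k where "k \<odot> x \<noteq> 0" "k \<odot> x \<in> S" using ess by blast
      then show ?thesis by (intro UnI2 UN_I[of k] UN_I[of "k \<odot> x"]) auto
    qed simp
  qed
  ultimately show ?thesis by (rule countable_subset[rotated])
qed

theorem uncountable_independent_family:
  assumes "uncountable (UNIV :: 'b set)"
  obtains I where "uncountable I" "independent_family I"
proof -
  obtain I where I: "independent_family I"
    "\<And>x. x \<noteq> 0 \<Longrightarrow> \<exists>k. k \<odot> x \<noteq> 0 \<and> k \<odot> x \<in> span I"
    using maximal_independent_family by blast
  have "uncountable I"
    using assms countable_essential_extension[OF countable_span subspace_span I(2)] by blast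
  with I(1) that show ?thesis by blast
qed

text \<open>
  Remove from \<open>I\<close> the finite supports of all members of \<open>P\<close> that lie in the span of \<open>I\<close>.
\<close>

lemma span_avoiding_countable:
  assumes I: "independent_family I" and P: "countable P"
  obtains C where "countable C" "C \<subseteq> I" "span (I - C) \<inter> P \<subseteq> {0}"
proof -
  have "\<exists>F. finite F \<and> F \<subseteq> I \<and> (x \<in> span I \<longrightarrow> x \<in> span F)" for x
    by (cases "x \<in> span I") (blast elim: span_finite_support)+
  then obtain F where F: "\<And>x. finite (F x)" "\<And>x. F x \<subseteq> I" "\<And>x. x \<in> span I \<Longrightarrow> x \<in> span (F x)"
    by metis
  define C where "C = (\<Union>x\<in>P. F x)"
  have "countable C" unfolding C_def by (rule countable_UN[OF P countable_finite[OF F(1)]])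
  moreover have "C \<subseteq> I" unfolding C_def using F(2) by blast
  moreover have zero: "x = 0" if "x \<in> span (I - C)" "x \<in> P" for x
  proof (rule independent_familyD[OF I F(2) _ _ F(3) that(1)])
    show "x \<in> span I" using that(1) span_mono[of "I - C" I] by blast
    show "F x \<inter> (I - C) = {}" using that(2) by (auto simp: C_def)
  qed auto
  then have "span (I - C) \<inter> P \<subseteq> {0}" by auto
  ultimately show ?thesis by (rule that)
qed

end

section \<open>The character group\<close>

typedef (overloaded) 'a character = "{\<phi> :: 'a::topological_ab_group_add \<Rightarrow> complex. is_character \<phi>}"
  morphisms eval_character character
  by (rule exI[of _ "\<lambda>_. 1"]) (simp add: is_character_def)

setup_lifting type_definition_character

instantiation character :: (topological_ab_group_add) ab_group_add
begin

lift_definition zero_character :: "'a character" is "\<lambda>_. 1"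
  by (simp add: is_character_def)

lift_definition plus_character :: "'a character \<Rightarrow> 'a character \<Rightarrow> 'a character"
  is "\<lambda>\<phi> \<psi> x. \<phi> x * \<psi> x"
  by (auto simp: is_character_def norm_mult intro!: continuous_intros)

lift_definition uminus_character :: "'a character \<Rightarrow> 'a character"
  is "\<lambda>\<phi> x. cnj (\<phi> x)"
  by (auto simp: is_character_def intro!: continuous_intros)

lift_definition minus_character :: "'a character \<Rightarrow> 'a character \<Rightarrow> 'a character"
  is "\<lambda>\<phi> \<psi> x. \<phi> x * cnj (\<psi> x)"
  by (auto simp: is_character_def norm_mult intro!: continuous_intros)

instance
proof
  fix a b c :: "'a character"
  show "a + b + c = a + (b + c)" by transfer (simp add: mult.assoc)
  show "a + b = b + a" by transfer (simp add: mult.commute)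
  show "0 + a = a" by transfer simp
  show "- a + a = 0"
  proof (transfer, rule ext)
    fix \<phi> :: "'a \<Rightarrow> complex" and x assume "is_character \<phi>"
    then have "cmod (\<phi> x) = 1" by (simp add: is_character_def)
    then show "cnj (\<phi> x) * \<phi> x = 1" by (metis complex_norm_square mult.commute of_real_1 power_one)
  qed
  show "a - b = a + - b" by transfer simp
qed

end

lemma continuous_eval_character: "continuous_on UNIV (eval_character \<phi>)"
  and eval_character_add: "eval_character \<phi> (x + y) = eval_character \<phi> x * eval_character \<phi> y"
  and cmod_eval_character [simp]: "cmod (eval_character \<phi> x) = 1"
  using eval_character[of \<phi>] by (auto simp: is_character_def)

lemma eval_character_nonzero [simp]: "eval_character \<phi> x \<noteq> 0"
  using cmod_eval_character[of \<phi> x] by (metis norm_zero zero_neq_one)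

lemma eval_character_0 [simp]: "eval_character \<phi> 0 = 1"
  using eval_character_add[of \<phi> 0 0] by simp

lemma eval_character_uminus: "eval_character \<phi> (- x) = cnj (eval_character \<phi> x)"
proof -
  have "eval_character \<phi> x * cnj (eval_character \<phi> x) = 1"
    by (metis cmod_eval_character complex_norm_square of_real_1 power_one)
  moreover have "eval_character \<phi> x * eval_character \<phi> (- x) = 1"
    by (simp flip: eval_character_add)
  ultimately show ?thesis by (metis eval_character_nonzero mult_left_cancel)
qed

lift_definition scale_character :: "int \<Rightarrow> 'a::topological_ab_group_add character \<Rightarrow> 'a character"
  is "\<lambda>k \<phi> x. \<phi> x powi k"
proof -
  fix k :: int and \<phi> :: "'a \<Rightarrow> complex" assume \<phi>: "is_character \<phi>"
  then have "\<phi> x \<noteq> 0" for x by (metis is_character_def norm_zero zero_neq_one)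
  with \<phi> have "continuous_on UNIV (\<lambda>x. \<phi> x powi k)"
    by (cases "k \<ge> 0") (auto simp: power_int_def is_character_def intro!: continuous_intros)
  with \<phi> show "is_character (\<lambda>x. \<phi> x powi k)"
    by (simp add: is_character_def power_int_mult_distrib norm_power_int)
qed

interpretation character: int_module "scale_character :: int \<Rightarrow> 'a::topological_ab_group_add character \<Rightarrow> _"
proof
  fix k l :: int and \<phi> \<psi> :: "'a character"
  show "scale_character k (\<phi> + \<psi>) = scale_character k \<phi> + scale_character k \<psi>"
    by transfer (simp add: power_int_mult_distrib)
  show "scale_character (k + l) \<phi> = scale_character k \<phi> + scale_character l \<phi>"
  proof (transfer, rule ext)
    fix k l :: int and \<phi> :: "'a \<Rightarrow> complex" and x assume "is_character \<phi>"
    then have "\<phi> x \<noteq> 0" by (metis is_character_def norm_zero zero_neq_one)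
    then show "\<phi> x powi (k + l) = \<phi> x powi k * \<phi> x powi l" by (simp add: power_int_add)
  qed
  show "scale_character k (scale_character l \<phi>) = scale_character (k * l) \<phi>"
    by transfer (simp add: mult.commute flip: power_int_mult)
  show "scale_character 1 \<phi> = \<phi>" by transfer simp
qed

context compact_ab_group
begin

lemma character_separates:
  fixes x y :: 'a
  assumes "x \<noteq> y"
  obtains \<phi> :: "'a character" where "eval_character \<phi> x \<noteq> eval_character \<phi> y"
proof -
  have "x - y \<noteq> 0" using assms by simp
  then obtain f where f: "is_character f" "f (x - y) \<noteq> 1"
    using characters_separate_points by blast
  define \<phi> where "\<phi> = character f"
  have "eval_character \<phi> (x - y) \<noteq> 1"
    using f by (simp add: \<phi>_def character_inverse)
  then have "eval_character \<phi> x \<noteq> eval_character \<phi> y"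
    using eval_character_add[of \<phi> "x - y" y] by auto
  then show ?thesis using that by blast
qed

lemma countable_characters_embedding:
  assumes "countable (UNIV :: 'a character set)"
  obtains f :: "'a \<Rightarrow> nat \<Rightarrow> complex" where "embedding_map euclidean euclidean f"
proof -
  obtain \<phi> :: "nat \<Rightarrow> 'a character" where \<phi>: "range \<phi> = UNIV"
    using uncountable_def assms by (metis UNIV_not_empty)
  define f where "f x n = eval_character (\<phi> n) x" for x n
  have "continuous_on UNIV f"
    by (rule continuous_on_coordinatewise_then_product)
      (use continuous_eval_character in \<open>simp add: f_def\<close>)
  then have cont: "continuous_map euclidean euclidean f" by simp
  have "inj f"
  proof (rule injI, rule ccontr)
    fix x y assume "f x = f y" "x \<noteq> y"
    then obtain \<psi> :: "'a character" where \<psi>: "eval_character \<psi> x \<noteq> eval_character \<psi> y"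
      using character_separates by blast
    obtain n where "\<psi> = \<phi> n" using \<phi> by blast
    then show False using \<psi> \<open>f x = f y\<close> by (metis f_def)
  qed
  moreover have "closed_map euclidean euclidean f"
    using cont compact_UNIV by (intro T1_Spaces.continuous_imp_closed_map) (auto simp: compact_space_def)
  ultimately have "embedding_map euclidean euclidean f"
    using cont by (intro injective_closed_imp_embedding_map) auto
  then show ?thesis using that by blast
qed

lemma countable_characters_metrizable:
  assumes "countable (UNIV :: 'a character set)"
  shows "metrizable_space (euclidean :: 'a topology)"
    and "second_countable (euclidean :: 'a topology)"
proof -
  obtain f :: "'a \<Rightarrow> nat \<Rightarrow> complex" where f: "embedding_map euclidean euclidean f"
    using countable_characters_embedding[OF assms] .
  then have hom: "(euclidean :: 'a topology) homeomorphic_space (top_of_set (range f))"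
    using embedding_map_imp_homeomorphic_space by fastforce
  have "metrizable_space (top_of_set (range f))"
    by (intro metrizable_space_subtopology metrizable_space_euclidean)
  then show "metrizable_space (euclidean :: 'a topology)"
    using hom homeomorphic_metrizable_space by blast
  have "second_countable (euclidean :: (nat \<Rightarrow> complex) topology)"
  proof -
    obtain B :: "(nat \<Rightarrow> complex) set set" where B: "countable B" "\<And>C. C \<in> B \<Longrightarrow> open C"
      "\<And>S. open S \<Longrightarrow> \<exists>U. U \<subseteq> B \<and> S = \<Union>U"
      using univ_second_countable by blast
    have "\<exists>V\<in>B. x \<in> V \<and> V \<subseteq> U" if "open U" "x \<in> U" for U x
      using B(3)[OF that(1)] that(2) by blast
    then show ?thesis unfolding second_countable_def using B(1,2) by auto
  qed
  then have "second_countable (top_of_set (range f))" by (rule second_countable_subtopology)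
  moreover obtain g where "homeomorphic_map (top_of_set (range f)) (euclidean :: 'a topology) g"
    using hom homeomorphic_space homeomorphic_space_sym by blast
  ultimately show "second_countable (euclidean :: 'a topology)"
    using second_countable_open_map_image unfolding homeomorphic_eq_everything_map by blast
qed

end

section \<open>Trigonometric polynomials with independent spectra\<close>

inductive_set trig_poly :: "'a::topological_ab_group_add character set \<Rightarrow> ('a \<Rightarrow> complex) set"
  for D where
  eval: "\<phi> \<in> D \<Longrightarrow> eval_character \<phi> \<in> trig_poly D"
| scale: "f \<in> trig_poly D \<Longrightarrow> (\<lambda>x. c * f x) \<in> trig_poly D"
| add: "f \<in> trig_poly D \<Longrightarrow> g \<in> trig_poly D \<Longrightarrow> (\<lambda>x. f x + g x) \<in> trig_poly D"

lemma continuous_trig_poly: "f \<in> trig_poly D \<Longrightarrow> continuous_on UNIV f"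
  by (induction rule: trig_poly.induct) (auto intro!: continuous_intros continuous_eval_character)

lemma eval_plus_character: "eval_character (\<phi> + \<psi>) x = eval_character \<phi> x * eval_character \<psi> x"
  and eval_uminus_character: "eval_character (- \<phi>) x = cnj (eval_character \<phi> x)"
  and eval_zero_character: "eval_character 0 x = 1"
  by (transfer, simp)+

lemma trig_poly_one: "character.subspace D \<Longrightarrow> (\<lambda>x. 1) \<in> trig_poly D"
  using trig_poly.eval[OF character.subspace_0] by (simp add: eval_zero_character[abs_def])

lemma trig_poly_mult:
  assumes D: "character.subspace D" and f: "f \<in> trig_poly D" and g: "g \<in> trig_poly D"
  shows "(\<lambda>x. f x * g x) \<in> trig_poly D"
  using f
proof induction
  case (eval \<phi>)
  show ?case using g
  proof induction
    case (eval \<psi>)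
    then show ?case
      using trig_poly.eval[OF character.subspace_add[OF D \<open>\<phi> \<in> D\<close> eval]]
      by (simp add: eval_plus_character[abs_def])
  next
    case (scale f c)
    then show ?case using trig_poly.scale[of _ D c] by (simp add: mult.left_commute)
  next
    case (add f g)
    then show ?case using trig_poly.add by (simp add: ring_distribs)
  qed
next
  case (scale f c)
  then show ?case using trig_poly.scale[of _ D c] by (simp add: mult.assoc)
next
  case (add f g)
  then show ?case using trig_poly.add by (simp add: ring_distribs)
qed

lemma trig_poly_power:
  assumes "character.subspace D" "f \<in> trig_poly D"
  shows "(\<lambda>x. f x ^ n) \<in> trig_poly D"
  by (induction n) (simp_all add: trig_poly_one trig_poly_mult assms)

lemma trig_poly_prod:
  assumes "character.subspace D" "\<And>i. i \<in> I \<Longrightarrow> f i \<in> trig_poly D"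
  shows "(\<lambda>x. \<Prod>i\<in>I. f i x) \<in> trig_poly D"
  using assms(2)
  by (induction I rule: infinite_finite_induct) (simp_all add: trig_poly_one trig_poly_mult assms(1))

text \<open>
  Maximal exactly where \<open>\<phi>\<close> agrees with its value at \<open>z\<close>.
\<close>

definition bump :: "'a::topological_ab_group_add \<Rightarrow> 'a character \<Rightarrow> 'a \<Rightarrow> real" where
  "bump z \<phi> x = (1 + Re (eval_character \<phi> (x - z))) / 2"

lemma bump_bounds: "0 \<le> bump z \<phi> x" "bump z \<phi> x \<le> 1"
  using abs_Re_le_cmod[of "eval_character \<phi> (x - z)"] by (auto simp: bump_def)

lemma bump_self: "bump z \<phi> z = 1"
  by (simp add: bump_def)

lemma bump_eq_1:
  assumes "bump z \<phi> x = 1"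
  shows "eval_character \<phi> x = eval_character \<phi> z"
proof -
  let ?w = "eval_character \<phi> (x - z)"
  have Re: "Re ?w = 1" using assms by (simp add: bump_def)
  have "(Re ?w)\<^sup>2 + (Im ?w)\<^sup>2 = 1" using cmod_power2[of ?w] by simp
  with Re have "?w = 1" by (simp add: complex_eq_iff)
  then show ?thesis using eval_character_add[of \<phi> "x - z" z] by simp
qed

lemma continuous_bump: "continuous_on UNIV (bump z \<phi>)"
  unfolding bump_def
  by (intro continuous_intros continuous_on_compose2[OF continuous_eval_character]) auto

lemma bump_trig_poly:
  assumes D: "character.subspace D" and "\<phi> \<in> D"
  shows "(\<lambda>x. of_real (bump z \<phi> x)) \<in> trig_poly D"
proof -
  let ?c = "eval_character \<phi> (- z)"
  have "complex_of_real (bump z \<phi> x)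
      = (1/2) * 1 + ((?c / 4) * eval_character \<phi> x + (cnj ?c / 4) * eval_character (- \<phi>) x)" for x
  proof -
    let ?w = "eval_character \<phi> (x - z)"
    have w: "?w = eval_character \<phi> x * ?c" using eval_character_add[of \<phi> x "- z"] by simp
    have "complex_of_real (bump z \<phi> x) = (1 + of_real (Re ?w)) / 2" by (simp add: bump_def)
    also have "complex_of_real (Re ?w) = (?w + cnj ?w) / 2" by (simp add: complex_add_cnj)
    finally show ?thesis unfolding w eval_uminus_character by (simp add: algebra_simps add_divide_distrib)
  qed
  note eq = this
  have "- \<phi> \<in> D" using character.subspace_neg[OF D \<open>\<phi> \<in> D\<close>] .
  then show ?thesis
    unfolding eq
    by (intro trig_poly.add trig_poly.scale trig_poly_one[OF D] trig_poly.eval \<open>\<phi> \<in> D\<close>)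
qed

context compact_ab_group
begin

lemma mean_character:
  fixes \<phi> :: "'a character"
  shows "mean (eval_character \<phi>) = (if \<phi> = 0 then 1 else 0)"
proof (cases "\<phi> = 0")
  case True
  then show ?thesis by (simp add: eval_zero_character[abs_def] mean_eqI[OF has_mean_const])
next
  case False
  then obtain a where a: "eval_character \<phi> a \<noteq> 1"
    by (metis eval_character_inject eval_zero_character ext)
  have "mean (eval_character \<phi>) = mean (\<lambda>x. eval_character \<phi> (x + a))"
    by (rule mean_translate[OF continuous_eval_character, symmetric])
  also have "\<dots> = mean (eval_character \<phi>) * eval_character \<phi> a"
    unfolding eval_character_add
    by (rule mean_bounded_linear[OF bounded_linear_mult_left continuous_eval_character])
  finally have "mean (eval_character \<phi>) * (1 - eval_character \<phi> a) = 0" by (simp add: algebra_simps)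
  then show ?thesis using a False by simp
qed

text \<open>
  By bilinearity it suffices to consider single characters, where the mean of a character is \<open>0\<close>
  unless it is trivial, and \<open>\<phi> + \<psi>\<close> is trivial only if \<open>\<phi>\<close> and \<open>\<psi>\<close> are.
\<close>

lemma mean_trig_poly_mult:
  fixes D E :: "'a character set"
  assumes D: "character.subspace D" and E: "character.subspace E" and DE: "D \<inter> E \<subseteq> {0}"
    and p: "p \<in> trig_poly D" and q: "q \<in> trig_poly E"
  shows "mean (\<lambda>x. p x * q x) = mean p * mean q"
  using p
proof induction
  case (eval \<phi>)
  note \<phi> = this
  show ?case using q
  proof induction
    case (eval \<psi>)
    have "\<phi> + \<psi> = 0 \<longleftrightarrow> \<phi> = 0 \<and> \<psi> = 0"
    proof
      assume sum: "\<phi> + \<psi> = 0"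
      then have "\<phi> = - \<psi>" by (simp add: eq_neg_iff_add_eq_0)
      then have "\<phi> \<in> E" using character.subspace_neg[OF E eval] by simp
      then have "\<phi> = 0" using \<phi> DE by blast
      then show "\<phi> = 0 \<and> \<psi> = 0" using sum by simp
    qed simp
    then show ?case
      using mean_character[of "\<phi> + \<psi>"] mean_character[of \<phi>] mean_character[of \<psi>]
      by (auto simp: eval_plus_character[abs_def])
  next
    case (scale f c)
    have "mean (\<lambda>x. c * (eval_character \<phi> x * f x)) = c * mean (\<lambda>x. eval_character \<phi> x * f x)"
      by (intro mean_bounded_linear bounded_linear_mult_right continuous_on_mult
          continuous_eval_character continuous_trig_poly[OF scale.hyps])
    moreover have "mean (\<lambda>x. c * f x) = c * mean f"
      by (intro mean_bounded_linear bounded_linear_mult_right continuous_trig_poly[OF scale.hyps])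
    ultimately show ?case using scale.IH by (simp add: mult.left_commute)
  next
    case (add f g)
    note c = add.hyps[THEN continuous_trig_poly]
    have "mean (\<lambda>x. eval_character \<phi> x * f x + eval_character \<phi> x * g x)
        = mean (\<lambda>x. eval_character \<phi> x * f x) + mean (\<lambda>x. eval_character \<phi> x * g x)"
      by (intro mean_add continuous_on_mult continuous_eval_character c)
    then show ?case using add.IH by (simp add: mean_add c ring_distribs)
  qed
next
  case (scale f c)
  note cont = continuous_trig_poly[OF scale.hyps] continuous_trig_poly[OF q]
  have "mean (\<lambda>x. c * (f x * q x)) = c * mean (\<lambda>x. f x * q x)"
    by (intro mean_bounded_linear bounded_linear_mult_right continuous_on_mult cont)
  moreover have "mean (\<lambda>x. c * f x) = c * mean f"
    by (intro mean_bounded_linear bounded_linear_mult_right cont)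
  ultimately show ?case using scale.IH by (simp add: mult.assoc)
next
  case (add f g)
  note c = add.hyps[THEN continuous_trig_poly] continuous_trig_poly[OF q]
  have "mean (\<lambda>x. f x * q x + g x * q x) = mean (\<lambda>x. f x * q x) + mean (\<lambda>x. g x * q x)"
    by (intro mean_add continuous_on_mult c)
  then show ?case using add.IH by (simp add: mean_add c ring_distribs)
qed

lemma mean_of_real:
  fixes f :: "'a \<Rightarrow> real"
  assumes "continuous_on UNIV f"
  shows "mean (\<lambda>x. complex_of_real (f x)) = of_real (mean f)"
  by (rule mean_bounded_linear[OF bounded_linear_of_real assms])

text \<open>
  Let \<open>P\<close> and \<open>Q\<close> be the products of the bumps for the two sets, with maximum \<open>1\<close> each, and let \<open>\<mu>\<close> be
  the maximum of \<open>P Q\<close>. The mean of \<open>(P Q) ^ n\<close> is at most \<open>\<mu> ^ n\<close>, but it is the product of the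
  means of \<open>P ^ n\<close> and \<open>Q ^ n\<close>, which decay more slowly than any geometric sequence of
  ratio below \<open>1\<close>. So \<open>\<mu> = 1\<close>, and all bumps equal \<open>1\<close> at a point where the maximum is attained.
\<close>

lemma finite_independent_prescription:
  fixes A B :: "'a character set" and z :: 'a
  assumes D: "character.subspace D" and E: "character.subspace E" and DE: "D \<inter> E \<subseteq> {0}"
    and A: "finite A" "A \<subseteq> D" and B: "finite B" "B \<subseteq> E"
  shows "\<exists>x. (\<forall>\<phi>\<in>A. eval_character \<phi> x = 1) \<and> (\<forall>\<psi>\<in>B. eval_character \<psi> x = eval_character \<psi> z)"
proof -
  define P where "P x = (\<Prod>\<phi>\<in>A. bump 0 \<phi> x)" for x
  define Q where "Q x = (\<Prod>\<psi>\<in>B. bump z \<psi> x)" for x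
  have Pc: "continuous_on UNIV P" and Qc: "continuous_on UNIV Q"
    unfolding P_def Q_def by (intro continuous_on_prod continuous_bump)+
  have bounds: "0 \<le> P x" "P x \<le> 1" "0 \<le> Q x" "Q x \<le> 1" for x
    unfolding P_def Q_def by (intro prod_nonneg prod_le_1 ballI bump_bounds conjI)+
  have one: "P 0 = 1" "Q z = 1" by (simp_all add: P_def Q_def bump_self)
  have Pt: "(\<lambda>x. complex_of_real (P x)) \<in> trig_poly D"
    unfolding P_def of_real_prod using A D by (intro trig_poly_prod bump_trig_poly) auto
  have Qt: "(\<lambda>x. complex_of_real (Q x)) \<in> trig_poly E"
    unfolding Q_def of_real_prod using B E by (intro trig_poly_prod bump_trig_poly) auto
  have PQc: "continuous_on UNIV (\<lambda>x. P x * Q x)" by (intro continuous_intros Pc Qc)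
  have split: "mean (\<lambda>x. (P x * Q x) ^ n) = mean (\<lambda>x. P x ^ n) * mean (\<lambda>x. Q x ^ n)" for n
  proof -
    have c: "continuous_on UNIV (\<lambda>x. P x ^ n)" "continuous_on UNIV (\<lambda>x. Q x ^ n)"
        "continuous_on UNIV (\<lambda>x. (P x * Q x) ^ n)"
      by (intro continuous_intros Pc Qc)+
    have "mean (\<lambda>x. complex_of_real (P x) ^ n * complex_of_real (Q x) ^ n)
        = mean (\<lambda>x. complex_of_real (P x) ^ n) * mean (\<lambda>x. complex_of_real (Q x) ^ n)"
      by (rule mean_trig_poly_mult[OF D E DE]) (intro trig_poly_power D E Pt Qt)+
    then have "complex_of_real (mean (\<lambda>x. (P x * Q x) ^ n))
        = of_real (mean (\<lambda>x. P x ^ n) * mean (\<lambda>x. Q x ^ n))"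
      using mean_of_real[OF c(1)] mean_of_real[OF c(2)] mean_of_real[OF c(3)]
      by (simp add: power_mult_distrib)
    then show ?thesis by (simp only: of_real_eq_iff)
  qed
  obtain x where max: "\<And>y. P y * Q y \<le> P x * Q x"
    using continuous_attains_sup[OF compact_UNIV UNIV_not_empty PQc] by blast
  define \<mu> where "\<mu> = P x * Q x"
  have \<mu>: "0 \<le> \<mu>" unfolding \<mu>_def using bounds by simp
  have "\<mu> \<ge> 1"
  proof (rule ccontr)
    assume "\<not> \<mu> \<ge> 1"
    \<comment> \<open>Any \<open>t < 1\<close> with \<open>\<mu> < t * t\<close> yields the contradiction.\<close>
    define t where "t = sqrt ((1 + \<mu>) / 2)"
    have t: "0 < t" "t < 1" "t * t = (1 + \<mu>) / 2" "\<mu> < t * t"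
      using \<mu> \<open>\<not> \<mu> \<ge> 1\<close> by (auto simp: t_def)
    obtain c where c: "c > 0" "\<And>n. c * t ^ n \<le> mean (\<lambda>x. P x ^ n)"
      using mean_power_ge[OF Pc bounds(1), of t 0] t one by auto
    obtain d where d: "d > 0" "\<And>n. d * t ^ n \<le> mean (\<lambda>x. Q x ^ n)"
      using mean_power_ge[OF Qc bounds(3), of t z] t one by auto
    have le: "(c * d) * (t * t) ^ n \<le> \<mu> ^ n" for n
    proof -
      have "(c * d) * (t * t) ^ n = (c * t ^ n) * (d * t ^ n)"
        by (simp add: power_mult_distrib mult_ac)
      also have "\<dots> \<le> mean (\<lambda>x. P x ^ n) * mean (\<lambda>x. Q x ^ n)"
        using c d t by (intro mult_mono) (auto intro: order_trans[rotated, OF c(2)])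
      also have "\<dots> = mean (\<lambda>x. (P x * Q x) ^ n)" by (rule split[symmetric])
      also have "\<dots> \<le> \<mu> ^ n"
      proof -
        have "norm ((P y * Q y) ^ n - 0) \<le> \<mu> ^ n" for y
          using power_mono[OF max[of y], of n] bounds[of y] by (simp add: \<mu>_def)
        moreover have "continuous_on UNIV (\<lambda>x. (P x * Q x) ^ n)" by (intro continuous_intros Pc Qc)
        ultimately have "norm (mean (\<lambda>x. (P x * Q x) ^ n) - 0) \<le> \<mu> ^ n" by (rule mean_norm_le[rotated])
        then show ?thesis by simp
      qed
      finally show ?thesis .
    qed
    define s where "s = \<mu> / (t * t)"
    have "0 \<le> s" "s < 1" using \<mu> t by (auto simp: s_def divide_less_eq)
    moreover have "0 < c * d" using c d by simp
    ultimately obtain n where "s ^ n < c * d" using real_arch_pow_inv by blast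
    moreover have "c * d \<le> s ^ n" using le[of n] t(1) by (simp add: s_def power_divide field_simps)
    ultimately show False by simp
  qed
  then have PQ: "P x = 1" "Q x = 1"
    using bounds[of x] mult_left_le[of "Q x" "P x"] mult_right_le_one_le[of "P x" "Q x"]
      mult_left_le_one_le[of "Q x" "P x"]
    unfolding \<mu>_def by linarith+
  have factor: "f i = 1" if "finite I" "i \<in> I" "(\<Prod>i\<in>I. f i) = 1" "\<And>i. 0 \<le> f i \<and> f i \<le> 1"
    for I and f :: "'a character \<Rightarrow> real" and i
  proof -
    have "(\<Prod>i\<in>I. f i) = f i * (\<Prod>i\<in>I - {i}. f i)" by (rule prod.remove[OF that(1,2)])
    also have "\<dots> \<le> f i" using that(4) by (intro mult_left_le prod_le_1 prod_nonneg) auto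
    finally show ?thesis using that(3,4) by (metis antisym)
  qed
  show ?thesis
  proof (intro exI[of _ x] conjI ballI)
    fix \<phi> assume "\<phi> \<in> A"
    then show "eval_character \<phi> x = 1"
      using factor[OF A(1), of \<phi> "\<lambda>\<phi>. bump 0 \<phi> x"] bump_eq_1[of 0 \<phi> x] PQ
      by (simp add: P_def bump_bounds)
  next
    fix \<psi> assume "\<psi> \<in> B"
    then show "eval_character \<psi> x = eval_character \<psi> z"
      using factor[OF B(1), of \<psi> "\<lambda>\<psi>. bump z \<psi> x"] bump_eq_1[of z \<psi> x] PQ
      by (simp add: Q_def bump_bounds)
  qed
qed

lemma independent_prescription:
  fixes D E :: "'a character set" and z :: 'a
  assumes D: "character.subspace D" and E: "character.subspace E" and DE: "D \<inter> E \<subseteq> {0}"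
  obtains x where "\<And>\<phi>. \<phi> \<in> D \<Longrightarrow> eval_character \<phi> x = 1"
    "\<And>\<psi>. \<psi> \<in> E \<Longrightarrow> eval_character \<psi> x = eval_character \<psi> z"
proof -
  define Z where "Z = (\<lambda>(\<phi>, \<psi>). {x. eval_character \<phi> x = 1 \<and> eval_character \<psi> x = eval_character \<psi> z})"
  have "UNIV \<inter> (\<Inter>i\<in>D \<times> E. Z i) \<noteq> {}"
  proof (rule compact_imp_fip_image[OF compact_UNIV])
    fix i show "closed (Z i)"
      unfolding Z_def split_beta
      by (intro closed_Collect_conj closed_Collect_eq continuous_eval_character continuous_on_const)
  next
    fix I assume I: "finite I" "I \<subseteq> D \<times> E"
    then have "finite (fst ` I)" "fst ` I \<subseteq> D" "finite (snd ` I)" "snd ` I \<subseteq> E" by auto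
    from finite_independent_prescription[OF D E DE this, of z]
    obtain x where x: "\<forall>\<phi>\<in>fst ` I. eval_character \<phi> x = 1"
      "\<forall>\<psi>\<in>snd ` I. eval_character \<psi> x = eval_character \<psi> z" by blast
    have "x \<in> Z i" if "i \<in> I" for i
      using x that by (auto simp: Z_def split_beta)
    then have "x \<in> (\<Inter>i\<in>I. Z i)" by blast
    then show "UNIV \<inter> (\<Inter>i\<in>I. Z i) \<noteq> {}" by blast
  qed
  then obtain x where x: "\<And>\<phi> \<psi>. \<phi> \<in> D \<Longrightarrow> \<psi> \<in> E \<Longrightarrow> x \<in> Z (\<phi>, \<psi>)" by blast
  have "0 \<in> D" "0 \<in> E" using D E character.subspace_0 by blast+
  then show ?thesis using x by (intro that[of x]) (auto simp: Z_def)
qed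

section \<open>A dense subgroup that is not separable\<close>

text \<open>
  For the coordinate projections of a power of the circle this is the \<open>\<Sigma>\<close>-product.
\<close>

definition sigma_subgroup :: "'a character set \<Rightarrow> 'a set" where
  "sigma_subgroup I = {x. countable {\<phi>\<in>I. eval_character \<phi> x \<noteq> 1}}"

lemma add_subgroup_sigma: "add_subgroup (sigma_subgroup I)"
  unfolding add_subgroup_def
proof (intro conjI ballI)
  show "0 \<in> sigma_subgroup I" by (simp add: sigma_subgroup_def)
next
  fix x y assume "x \<in> sigma_subgroup I" "y \<in> sigma_subgroup I"
  then have un: "countable ({\<phi>\<in>I. eval_character \<phi> x \<noteq> 1} \<union> {\<phi>\<in>I. eval_character \<phi> y \<noteq> 1})"
    by (simp add: sigma_subgroup_def)
  have "{\<phi>\<in>I. eval_character \<phi> (x + y) \<noteq> 1}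
      \<subseteq> {\<phi>\<in>I. eval_character \<phi> x \<noteq> 1} \<union> {\<phi>\<in>I. eval_character \<phi> y \<noteq> 1}"
    by (auto simp: eval_character_add)
  then show "x + y \<in> sigma_subgroup I"
    unfolding sigma_subgroup_def using countable_subset[OF _ un] by blast
next
  fix x assume "x \<in> sigma_subgroup I"
  then show "- x \<in> sigma_subgroup I" by (simp add: sigma_subgroup_def eval_character_uminus)
qed

text \<open>
  Finitely many characters, the set \<open>B\<close>, exclude the complement of a neighbourhood of \<open>z\<close>. A point at
  which \<open>B\<close> agrees with its values at \<open>z\<close> and all but countably many members of \<open>I\<close> take the value
  \<open>1\<close> therefore lies in both the neighbourhood and the subgroup; it exists since \<open>B\<close> generates a
  countable group, which meets the span of \<open>I\<close> trivially after the removal of countably many members.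
\<close>

lemma dense_sigma_subgroup:
  assumes I: "character.independent_family I"
  shows "closure (sigma_subgroup I) = UNIV"
proof -
  have "U \<inter> sigma_subgroup I \<noteq> {}" if U: "open U" "z \<in> U" for U z
  proof -
    define O' where "O' \<psi> = {x. eval_character \<psi> x \<noteq> eval_character \<psi> z}" for \<psi> :: "'a character"
    have op: "open (O' \<psi>)" if "\<psi> \<in> UNIV" for \<psi>
      unfolding O'_def by (intro open_Collect_neq continuous_eval_character continuous_on_const)
    have comp: "compact (- U)" using compact_Int_closed[OF compact_UNIV, of "- U"] U(1) by (simp add: closed_Compl)
    have cov: "- U \<subseteq> (\<Union>\<psi>\<in>UNIV. O' \<psi>)"
    proof
      fix y assume "y \<in> - U"
      then have "y \<noteq> z" using U(2) by blast
      then obtain \<psi> :: "'a character" where "eval_character \<psi> y \<noteq> eval_character \<psi> z"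
        using character_separates by blast
      then show "y \<in> (\<Union>\<psi>\<in>UNIV. O' \<psi>)" by (auto simp: O'_def)
    qed
    obtain B where "B \<subseteq> UNIV" and B: "finite B" "- U \<subseteq> (\<Union>\<psi>\<in>B. O' \<psi>)"
      by (rule compactE_image[OF comp op cov])
    have "countable (character.span B)"
      by (rule character.countable_span[OF countable_finite[OF B(1)]])
    from character.span_avoiding_countable[OF I this] obtain C where
      C: "countable C" "C \<subseteq> I" "character.span (I - C) \<inter> character.span B \<subseteq> {0}" .
    from independent_prescription[OF character.subspace_span character.subspace_span C(3), of z]
    obtain x where x: "\<And>\<phi>. \<phi> \<in> character.span (I - C) \<Longrightarrow> eval_character \<phi> x = 1"
      "\<And>\<psi>. \<psi> \<in> character.span B \<Longrightarrow> eval_character \<psi> x = eval_character \<psi> z" by blast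
    have "{\<phi>\<in>I. eval_character \<phi> x \<noteq> 1} \<subseteq> C" using x(1) character.span_base by blast
    then have "x \<in> sigma_subgroup I"
      unfolding sigma_subgroup_def using C(1) countable_subset by blast
    moreover have "x \<in> U"
    proof (rule ccontr)
      assume "x \<notin> U"
      then obtain \<psi> where "\<psi> \<in> B" "eval_character \<psi> x \<noteq> eval_character \<psi> z"
        using B(2) by (auto simp: O'_def)
      then show False using x(2) character.span_base by blast
    qed
    ultimately show ?thesis by blast
  qed
  then show ?thesis unfolding closure_iff_nhds_not_empty set_eq_iff by blast
qed

text \<open>
  On countably many points of the subgroup all but countably many members of \<open>I\<close> take the value
  \<open>1\<close>; so these points lie in the kernel of a nontrivial character, which is closed and not dense.
\<close>

lemma not_separable_sigma_subgroup:
  assumes I: "character.independent_family I" "uncountable I"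
  shows "\<not> separable_space (top_of_set (sigma_subgroup I))"
proof
  assume "separable_space (top_of_set (sigma_subgroup I))"
  then obtain S where S: "countable S" "S \<subseteq> sigma_subgroup I"
    "top_of_set (sigma_subgroup I) closure_of S = sigma_subgroup I"
    by (auto simp: separable_space_def)
  have "sigma_subgroup I \<subseteq> closure S"
    using S(3) closure_of_subtopology_subset[of euclidean "sigma_subgroup I" S]
    by (simp add: euclidean_closure_of)
  then have "closure S = UNIV"
    using dense_sigma_subgroup[OF I(1)] closure_minimal[OF _ closed_closure] by blast
  define E where "E = (\<Union>x\<in>S. {\<phi>\<in>I. eval_character \<phi> x \<noteq> 1})"
  have "countable E" unfolding E_def
    using S(1,2) by (intro countable_UN) (auto simp: sigma_subgroup_def)
  then have "\<not> I \<subseteq> E" using I(2) countable_subset[of I E] by blast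
  then obtain \<phi> where \<phi>: "\<phi> \<in> I" "\<phi> \<notin> E" by blast
  have "S \<subseteq> {x. eval_character \<phi> x = 1}" using \<phi> by (auto simp: E_def)
  moreover have "closed {x. eval_character \<phi> x = 1}"
    by (intro closed_Collect_eq continuous_eval_character continuous_on_const)
  ultimately have "closure S \<subseteq> {x. eval_character \<phi> x = 1}" by (rule closure_minimal)
  then have "eval_character \<phi> x = eval_character 0 x" for x
    using \<open>closure S = UNIV\<close> by (auto simp: eval_zero_character)
  then have "\<phi> = 0" by (metis eval_character_inject ext)
  then show False using \<phi>(1) I(1) by (simp add: character.independent_family_def)
qed

theorem countable_characters_if_dense_subgroup_separable:
  assumes "dense_subgroup_separable (UNIV :: 'a set)"
  shows "countable (UNIV :: 'a character set)"
proof (rule ccontr)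
  assume "uncountable (UNIV :: 'a character set)"
  from character.uncountable_independent_family[OF this] obtain I :: "'a character set"
    where I: "uncountable I" "character.independent_family I" .
  have "separable_space (top_of_set (sigma_subgroup I))"
    using assms add_subgroup_sigma dense_sigma_subgroup[OF I(2)]
    by (simp add: dense_subgroup_separable_def euclidean_closure_of)
  then show False using not_separable_sigma_subgroup[OF I(2,1)] by blast
qed

end

theorem theorem3p6:
  assumes "compact (UNIV :: 'a::{topological_ab_group_add, t2_space} set)"
    and "torsion_free (UNIV :: 'a set)"
    and "dense_subgroup_separable (UNIV :: 'a set)"
  shows "metrizable_space (euclidean :: 'a topology) \<and>
    dense_separable_space (euclidean :: 'a topology)"
proof -
  interpret compact_ab_group "TYPE('a)" by unfold_locales (rule assms(1))
  note countable = countable_characters_if_dense_subgroup_separable[OF assms(3)]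
  have "separable_space (top_of_set D)" for D :: "'a set"
    by (intro second_countable_imp_separable_space second_countable_subtopology
        countable_characters_metrizable(2) countable)
  then show ?thesis
    using countable_characters_metrizable(1)[OF countable] by (simp add: dense_separable_space_def)
qed

end
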